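(* For each $m\in\mathbb N$ let $\mathscr P^{(m)}$ be a random partition of $[m]$ with induced random equivalence relation $\stackrel{m}{\sim}$, and let the partition elements be coloured by independent copies of a real-valued random variable $Y$ with $\mathbf E[Y]=0$ and $0<\mathbf E[Y^4]<\infty$; write $Y_i^{(m)}$ for the colour of the partition element containing $i\in[m]$, and $Z_k^{(m)}:=\sum_{i=1}^kY_i^{(m)}$. Fix $d\in\mathbb N$ and real numbers $0=\rho_0<\rho_1<\cdots<\rho_d=1$. For all $m\in\mathbb N$ let $\mathscr I^{(m)},\mathscr J^{(m)},\mathscr K^{(m)},\mathscr L^{(m)}$ be independent and uniformly distributed on $[m]$, and independent of $\mathscr P^{(m)}$ and of $(Y_i^{(m)})_{i\in[m]}$. Assume that the following conditions are satisfied: (i) $\mathbf P\left(\mathscr I^{(m)}\stackrel m\sim\mathscr J^{(m)}\stackrel m\sim\mathscr K^{(m)}\right)=o\left(\left(\mathbf P\left(\mathscr I^{(m)}\stackrel m\sim\mathscr J^{(m)}\right)\right)^{3/2}\right)$ as $m\to\infty$; (ii) $\mathbf P\left(\mathscr I^{(m)}\stackrel m\sim\mathscr J^{(m)}\stackrel m\sim\mathscr K^{(m)}\stackrel m\sim\mathscr L^{(m)}\right)=o\left(\left(\mathbf P\left(\mathscr I^{(m)}\stackrel m\sim\mathscr J^{(m)}\right)\right)^{2}\right)$ as $m\to\infty$; (iii) $\mathbf{Cov}\left[I_{\{i\stackrel m\sim j\}},I_{\{k\stackrel m\sim\ell\}}\right]\le\mathbf P\left(i\stackrel m\sim j\stackrel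 m\sim k\stackrel m\sim\ell\right)$ for all $m\in\mathbb N$ and $i,j,k,\ell\in[m]$; (iv) for all $(\alpha_1,\ldots,\alpha_d)\in\mathbb R^d\setminus\{(0,\ldots,0)\}$, setting $a_i^{(m)}:=\alpha_g$ if $\lfloor\rho_{g-1}m\rfloor<i\le\lfloor\rho_gm\rfloor$ ($i=1,\ldots,m$; $g=1,\ldots,d$), there exists a constant $\widetilde C>0$ (not depending on $m$) such that $$\sum_{i,j=1}^ma_i^{(m)}a_j^{(m)}\,\mathbf P\left(i\stackrel m\sim j\right)\ge\widetilde C\sum_{i,j=1}^m\mathbf P\left(i\stackrel m\sim j\right),\qquad m\in\mathbb N.$$ Then the sequence of $\mathbb R^d$-valued random variables $$\mathcal Z^{(m)}:=\left(Z^{(m)}_{\lfloor\rho_1m\rfloor},\ldots,Z^{(m)}_{\lfloor\rho_dm\rfloor}\right)$$ is asymptotically Gaussian as $m\to\infty$.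
   Context: Here $\mathbb N=\{1,2,\ldots\}$, $[m]=\{1,\ldots,m\}$, and $I_E$ is the indicator of an event $E$. $i\stackrel m\sim j$ means that $i$ and $j$ belong to the same element of $\mathscr P^{(m)}$; no consistency between different $m$ is assumed. Given the partition, the colours of distinct partition elements are independent copies of $Y$, the colours being independent of the partition. A sequence of centered $\mathbb R^d$-valued random vectors $X_m=(X_m^1,\ldots,X_m^d)$ with finite second moments is called asymptotically Gaussian if for every $(\beta_1,\ldots,\beta_d)\in\mathbb R^d\setminus\{0\}$ the linear combination $V_m:=\sum_{g=1}^d\beta_gX_m^g$ has positive variance for all sufficiently large $m$, and $V_m/\sqrt{\mathbf{Var}[V_m]}$ converges in distribution to a standard normal random variable. *)

theory Defs
  imports "HOL-Probability.Probability" "HOL-Library.Landau_Symbols"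
begin

text \<open>A random partition of \<open>{1..m}\<close> is a map \<open>P\<close> from a sample space \<open>'w\<close> into
  \<open>nat set set\<close>, a colouring is a family \<open>C\<close> of real random variables indexed by the possible
  partition elements.\<close>

definition same_part :: "nat set set \<Rightarrow> nat \<Rightarrow> nat \<Rightarrow> bool" where
  "same_part p i j \<longleftrightarrow> (\<exists>B\<in>p. i \<in> B \<and> j \<in> B)"

definition part_of :: "nat set set \<Rightarrow> nat \<Rightarrow> nat set" where
  "part_of p i = (THE B. B \<in> p \<and> i \<in> B)"

definition partition_space :: "nat \<Rightarrow> nat set set measure" where
  "partition_space m = count_space {p. partition_on {1..m} p}"

text \<open>Conditionally on every value \<open>p\<close> that the partition attains with positive probability, the
  colours of the elements of \<open>p\<close> are independent and distributed as \<open>Y\<close>. As the conditional law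
  of the colours depends on \<open>p\<close> only through the labels of its elements, this includes the
  independence of the colours from the partition. The values \<open>C B \<omega>\<close> with \<open>B \<notin> P \<omega>\<close> are
  irrelevant; only their measurability is required.\<close>

definition iid_coloured_partition ::
  "'w measure \<Rightarrow> nat \<Rightarrow> ('w \<Rightarrow> nat set set) \<Rightarrow> (nat set \<Rightarrow> 'w \<Rightarrow> real) \<Rightarrow>
   'y measure \<Rightarrow> ('y \<Rightarrow> real) \<Rightarrow> bool" where
  "iid_coloured_partition M m P C N Y \<longleftrightarrow>
     P \<in> measurable M (partition_space m) \<and>
     (\<forall>B. B \<subseteq> {1..m} \<and> B \<noteq> {} \<longrightarrow> C B \<in> borel_measurable M) \<and>
     (\<forall>p. measure M {\<omega> \<in> space M. P \<omega> = p} > 0 \<longrightarrow>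
        (let Q = uniform_measure M {\<omega> \<in> space M. P \<omega> = p} in
           prob_space.indep_vars Q (\<lambda>_. borel) C p \<and>
           (\<forall>B\<in>p. distr Q borel (C B) = distr N borel Y)))"

definition colour_at :: "('w \<Rightarrow> nat set set) \<Rightarrow> (nat set \<Rightarrow> 'w \<Rightarrow> real) \<Rightarrow> nat \<Rightarrow> 'w \<Rightarrow> real" where
  "colour_at P C i \<omega> = C (part_of (P \<omega>) i) \<omega>"

definition colour_sum :: "('w \<Rightarrow> nat set set) \<Rightarrow> (nat set \<Rightarrow> 'w \<Rightarrow> real) \<Rightarrow> nat \<Rightarrow> 'w \<Rightarrow> real" where
  "colour_sum P C k \<omega> = (\<Sum>i=1..k. colour_at P C i \<omega>)"

text \<open>The last conjunct is the independence of the \<open>\<sigma>\<close>-algebra generated by \<open>I, J, K, L\<close> from the one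
  generated by the partition together with the colours of \<open>1, \<dots>, m\<close>; \<open>indep_var\<close> does not apply,
  since it wants random variables with values in the same type.\<close>

definition independent_uniform_indices ::
  "'w measure \<Rightarrow> nat \<Rightarrow> ('w \<Rightarrow> nat set set) \<Rightarrow> (nat \<Rightarrow> 'w \<Rightarrow> real) \<Rightarrow>
   ('w \<Rightarrow> nat) \<Rightarrow> ('w \<Rightarrow> nat) \<Rightarrow> ('w \<Rightarrow> nat) \<Rightarrow> ('w \<Rightarrow> nat) \<Rightarrow> bool" where
  "independent_uniform_indices M m P Yc I J K L \<longleftrightarrow>
     (\<forall>X\<in>{I, J, K, L}. X \<in> measurable M (count_space UNIV) \<and>
        distr M (count_space UNIV) X = measure_pmf (pmf_of_set {1..m})) \<and>
     prob_space.indep_vars M (\<lambda>_. count_space UNIV) (\<lambda>n::nat. [I, J, K, L] ! n) {0..<4} \<and>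
     prob_space.indep_set M
       (sets (vimage_algebra (space M) (\<lambda>\<omega>. (I \<omega>, J \<omega>, K \<omega>, L \<omega>)) (count_space UNIV)))
       (sets (vimage_algebra (space M) (\<lambda>\<omega>. (P \<omega>, restrict (\<lambda>i. Yc i \<omega>) {1..m}))
          (partition_space m \<Otimes>\<^sub>M PiM {1..m} (\<lambda>_. borel))))"

definition covariance :: "'w measure \<Rightarrow> ('w \<Rightarrow> real) \<Rightarrow> ('w \<Rightarrow> real) \<Rightarrow> real" where
  "covariance M U V =
     (\<integral>\<omega>. (U \<omega> - (\<integral>\<omega>'. U \<omega>' \<partial>M)) * (V \<omega> - (\<integral>\<omega>'. V \<omega>' \<partial>M)) \<partial>M)"

text \<open>The coefficient \<open>a\<^sub>i\<close>: the value \<open>\<alpha> g\<close> for the unique \<open>g\<close> whose range contains \<open>i\<close>.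
  For small \<open>m\<close> some of the ranges are empty (for \<open>m = 1\<close> all but the last), so that for \<open>d \<ge> 2\<close> a
  lower bound on a quadratic form in the \<open>a\<^sub>i\<close>, uniform in \<open>m\<close>, can only be asked for large \<open>m\<close>.\<close>

definition step_coeff ::
  "nat \<Rightarrow> (nat \<Rightarrow> real) \<Rightarrow> (nat \<Rightarrow> real) \<Rightarrow> nat \<Rightarrow> nat \<Rightarrow> real" where
  "step_coeff d \<rho> \<alpha> m i =
     \<alpha> (THE g. g \<in> {1..d} \<and> nat \<lfloor>\<rho> (g - 1) * real m\<rfloor> < i \<and> i \<le> nat \<lfloor>\<rho> g * real m\<rfloor>)"

text \<open>The vector \<open>X\<^sub>m\<close> has the coordinates \<open>X m g\<close> with \<open>g \<in> {1..d}\<close> and lives on the probability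
  space \<open>M m\<close>. The sequence starts at \<open>m = 1\<close>.\<close>

definition asymptotically_Gaussian ::
  "nat \<Rightarrow> (nat \<Rightarrow> 'w measure) \<Rightarrow> (nat \<Rightarrow> nat \<Rightarrow> 'w \<Rightarrow> real) \<Rightarrow> bool" where
  "asymptotically_Gaussian d M X \<longleftrightarrow>
     (\<forall>m\<ge>1. \<forall>g\<in>{1..d}. X m g \<in> borel_measurable (M m) \<and>
        integrable (M m) (\<lambda>\<omega>. (X m g \<omega>)\<^sup>2) \<and> prob_space.expectation (M m) (X m g) = 0) \<and>
     (\<forall>\<beta>. (\<exists>g\<in>{1..d}. \<beta> g \<noteq> 0) \<longrightarrow>
        (let V = (\<lambda>m \<omega>. \<Sum>g=1..d. \<beta> g * X m g \<omega>) in
           (\<forall>\<^sub>F m in sequentially. prob_space.variance (M m) (V m) > 0) \<and>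
           weak_conv_m
             (\<lambda>m. distr (M m) borel (\<lambda>\<omega>. V m \<omega> / sqrt (prob_space.variance (M m) (V m))))
             std_normal_distribution))"

end

theory Submission
  imports Defs
begin

text \<open>
  A linear combination of the coordinates is a weighted sum \<open>V = (\<Sum>i\<le>m. a\<^sub>i Y\<^sub>i)\<close>, where the \<open>a\<^sub>i\<close>
  are bounded by a constant and depend on \<open>i\<close> through its block between the points
  \<open>\<lfloor>\<rho>\<^sub>g m\<rfloor>\<close>. Given the partition, \<open>V\<close> is a sum of independent variables
  \<open>w\<^sub>B C\<^sub>B\<close>, one for each partition element \<open>B\<close>, with \<open>w\<^sub>B = (\<Sum>i\<in>B. a\<^sub>i)\<close>. Asymptotic
  normality follows from two facts: the conditional law is close to a Gaussian one, and its
  variance, a multiple of \<open>W = (\<Sum>B. w\<^sub>B\<^sup>2)\<close>, hardly fluctuates.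

  \<^item> A third order expansion of the characteristic function of \<open>Y\<close> shows that the conditional
    characteristic function of \<open>V\<close> at \<open>t\<close> differs from the Gaussian one by at most a constant times
    \<open>\<bar>t\<bar>\<^sup>3 (\<Sum>B. \<bar>w\<^sub>B\<bar>\<^sup>3)\<close>. The expectation of \<open>(\<Sum>B. \<bar>B\<bar>\<^sup>3)\<close> counts triples
    of equivalent indices, so hypothesis \<open>i\<close> makes this error negligible on the scale
    of the standard deviation (\<open>linear_form_char\<close>).

  \<^item> The variance of \<open>W\<close> is a combination of the covariances of the events \<open>i \<sim> j\<close> and
    \<open>k \<sim> l\<close>, with coefficients of either sign; hypothesis \<open>iii\<close> bounds these covariances only from
    above. However, for \<open>a = 1\<close> the combination is a variance, so
    the covariances have a nonnegative sum. Hence their negative parts add up to no more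
    than their positive parts, and the sum of their absolute values is at most twice the number of
    equivalent quadruples expected (\<open>weight_square_variance_bound\<close>). Hypothesis \<open>ii\<close> makes this
    negligible compared with \<open>(\<^bold>E W)\<^sup>2\<close>.

  Hypothesis \<open>iv\<close> enters since it bounds \<open>\<^bold>E W\<close> from below by a multiple of the expected number of
  equivalent pairs, which is the quantity that \<open>i\<close> and \<open>ii\<close> refer to. The convergence
  of the characteristic functions gives the result by Levy's continuity theorem.
\<close>

section \<open>Partitions and sums over their elements\<close>

lemma part_of_eq:
  assumes "partition_on A p" "B \<in> p" "i \<in> B"
  shows "part_of p i = B"
  unfolding part_of_def
  using assms partition_onD2[OF assms(1)] unfolding disjoint_def by (intro the_equality) blast+

lemma part_of_mem:
  assumes "partition_on A p" "i \<in> A"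
  shows "part_of p i \<in> p" "i \<in> part_of p i"
proof -
  obtain B where "B \<in> p" "i \<in> B"
    using assms by (auto dest: partition_onD1)
  with part_of_eq[OF assms(1) this] show "part_of p i \<in> p" "i \<in> part_of p i"
    by auto
qed

lemma same_part_iff:
  assumes "partition_on A p" "i \<in> A"
  shows "same_part p i j \<longleftrightarrow> j \<in> part_of p i"
  unfolding same_part_def
  using part_of_mem[OF assms] part_of_eq[OF assms(1)] by metis

lemma sum_over_blocks:
  fixes f :: "nat set \<Rightarrow> nat \<Rightarrow> 'b::comm_monoid_add"
  assumes "partition_on A p" "finite A"
  shows "(\<Sum>B\<in>p. \<Sum>i\<in>B. f B i) = (\<Sum>i\<in>A. f (part_of p i) i)"
proof -
  have fin: "finite B" if "B \<in> p" for B
    using assms(2) that unfolding partition_onD1[OF assms(1)] by (meson Union_upper finite_subset)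
  have "(\<Sum>i\<in>A. f (part_of p i) i) = (\<Sum>i\<in>\<Union>p. f (part_of p i) i)"
    using assms(1) by (simp add: partition_onD1[symmetric])
  also have "\<dots> = (\<Sum>B\<in>p. \<Sum>i\<in>B. f (part_of p i) i)"
    using fin partition_onD2[OF assms(1)]
    by (subst sum.Union_disjoint) (auto simp: disjoint_def)
  also have "\<dots> = (\<Sum>B\<in>p. \<Sum>i\<in>B. f B i)"
    using part_of_eq[OF assms(1)] by (intro sum.cong) auto
  finally show ?thesis ..
qed

lemma sum_block_part_of:
  fixes f :: "nat \<Rightarrow> real"
  assumes "partition_on A p" "finite A" "i \<in> A"
  shows "(\<Sum>j\<in>part_of p i. f j) = (\<Sum>j\<in>A. f j * of_bool (same_part p i j))"
proof -
  have "part_of p i \<subseteq> A"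
    using part_of_mem[OF assms(1,3)] partition_onD1[OF assms(1)] by auto
  then have "(\<Sum>j\<in>part_of p i. f j) = (\<Sum>j\<in>A. if j \<in> part_of p i then f j else 0)"
    using assms(2) by (simp add: sum.If_cases Int_absorb1)
  also have "\<dots> = (\<Sum>j\<in>A. f j * of_bool (same_part p i j))"
    by (intro sum.cong) (auto simp: same_part_iff[OF assms(1,3)])
  finally show ?thesis .
qed

text \<open>The next two identities turn power sums over the partition elements into counts of equivalent
  tuples, whose expectations are the probabilities in the hypotheses.\<close>
lemma sum_squared_block_weights:
  fixes a :: "nat \<Rightarrow> real"
  assumes "partition_on A p" "finite A"
  shows "(\<Sum>B\<in>p. (\<Sum>i\<in>B. a i)\<^sup>2) = (\<Sum>i\<in>A. \<Sum>j\<in>A. a i * a j * of_bool (same_part p i j))"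
proof -
  have "(\<Sum>B\<in>p. (\<Sum>i\<in>B. a i)\<^sup>2) = (\<Sum>B\<in>p. \<Sum>i\<in>B. a i * (\<Sum>j\<in>B. a j))"
    by (simp add: power2_eq_square sum_distrib_right)
  also have "\<dots> = (\<Sum>i\<in>A. a i * (\<Sum>j\<in>part_of p i. a j))"
    by (rule sum_over_blocks[OF assms])
  also have "\<dots> = (\<Sum>i\<in>A. a i * (\<Sum>j\<in>A. a j * of_bool (same_part p i j)))"
    using assms by (intro sum.cong refl arg_cong2[where f="(*)"] sum_block_part_of)
  finally show ?thesis by (simp add: sum_distrib_left mult.assoc)
qed

lemma sum_cubed_block_cards:
  assumes "partition_on A p" "finite A"
  shows "(\<Sum>B\<in>p. real (card B) ^ 3) =
    (\<Sum>i\<in>A. \<Sum>j\<in>A. \<Sum>k\<in>A. of_bool (same_part p i j \<and> same_part p j k))"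
proof -
  have "(\<Sum>B\<in>p. real (card B) ^ 3) = (\<Sum>B\<in>p. \<Sum>i\<in>B. \<Sum>j\<in>B. \<Sum>k\<in>B. 1)"
    by (simp add: power3_eq_cube mult.assoc)
  also have "\<dots> = (\<Sum>i\<in>A. \<Sum>j\<in>part_of p i. \<Sum>k\<in>part_of p i. 1)"
    by (rule sum_over_blocks[OF assms])
  also have "\<dots> = (\<Sum>i\<in>A. \<Sum>j\<in>A. \<Sum>k\<in>A. of_bool (same_part p i j \<and> same_part p j k))"
  proof (rule sum.cong[OF refl])
    fix i assume i: "i \<in> A"
    have "(\<Sum>j\<in>part_of p i. \<Sum>k\<in>part_of p i. 1::real) =
        (\<Sum>j\<in>A. (\<Sum>k\<in>A. of_bool (same_part p i k)) * of_bool (same_part p i j))"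
      using sum_block_part_of[OF assms i, of "\<lambda>_. 1"]
        sum_block_part_of[OF assms i, of "\<lambda>_. \<Sum>k\<in>part_of p i. 1"] by simp
    also have "\<dots> = (\<Sum>j\<in>A. \<Sum>k\<in>A. of_bool (same_part p i j \<and> same_part p j k))"
      unfolding sum_distrib_right
    proof (intro sum.cong refl)
      fix j k assume j: "j \<in> A" and k: "k \<in> A"
      have "part_of p i = part_of p j" if "same_part p i j"
        using that same_part_iff[OF assms(1) i] part_of_eq[OF assms(1)] part_of_mem[OF assms(1) i] by metis
      then have "same_part p i j \<and> same_part p i k \<longleftrightarrow> same_part p i j \<and> same_part p j k"
        using same_part_iff[OF assms(1) i] same_part_iff[OF assms(1) j] by auto
      then show "of_bool (same_part p i k) * of_bool (same_part p i j) =
          (of_bool (same_part p i j \<and> same_part p j k) :: real)"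
        by (auto simp: of_bool_def)
    qed
    finally show "(\<Sum>j\<in>part_of p i. \<Sum>k\<in>part_of p i. 1::real) =
        (\<Sum>j\<in>A. \<Sum>k\<in>A. of_bool (same_part p i j \<and> same_part p j k))" .
  qed
  finally show ?thesis .
qed

section \<open>Elementary estimates and conditioning\<close>

text \<open>The error of the expansion is at most \<open>v\<^sup>4\<close> for small \<open>v\<close> and at most \<open>v\<^sup>2\<close> for large \<open>v\<close>;
  the cube dominates the better of the two bounds and matches the third order error of a general
  characteristic function.\<close>
lemma exp_minus_square_approx:
  fixes v :: real
  shows "\<bar>exp (- (v\<^sup>2)) - (1 - v\<^sup>2)\<bar> \<le> \<bar>v\<bar> ^ 3"
proof -
  define y where "y = v\<^sup>2"
  have y: "y \<ge> 0" by (simp add: y_def)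
  have lower: "1 - y \<le> exp (- y)"
    using exp_ge_add_one_self[of "-y"] by simp
  have "exp (- y) * (1 + y) \<le> exp (- y) * exp y"
    by (intro mult_left_mono) (auto simp: exp_ge_add_one_self)
  also have "\<dots> = 1" by (simp add: exp_minus)
  also have "1 \<le> (1 - y + y\<^sup>2) * (1 + y)"
    using y by (simp add: algebra_simps power2_eq_square)
  finally have upper: "exp (- y) \<le> 1 - y + y\<^sup>2"
    using y by (simp add: mult_le_cancel_right)
  show ?thesis
  proof (cases "\<bar>v\<bar> \<le> 1")
    case True
    have "y\<^sup>2 = \<bar>v\<bar> ^ 4" by (simp add: y_def power_mult[symmetric])
    also have "\<dots> \<le> \<bar>v\<bar> ^ 3" using True by (intro power_decreasing) auto
    finally show ?thesis using lower upper by (simp add: y_def)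
  next
    case False
    then have "y \<le> \<bar>v\<bar> ^ 3"
      using power_increasing[of 2 3 "\<bar>v\<bar>"] by (simp add: y_def)
    moreover have "exp (- y) \<le> 1" using y by simp
    ultimately show ?thesis using lower y unfolding y_def by linarith
  qed
qed

lemma abs_exp_minus_diff_le:
  fixes x y :: real
  assumes "0 \<le> x" "0 \<le> y"
  shows "\<bar>exp (- x) - exp (- y)\<bar> \<le> \<bar>x - y\<bar>"
proof -
  have *: "\<bar>exp (- x) - exp (- y)\<bar> \<le> \<bar>x - y\<bar>" if "0 \<le> x" "x \<le> y" for x y :: real
  proof -
    have "exp (- x) - exp (- y) = exp (- x) * (1 - exp (- (y - x)))"
      by (simp add: algebra_simps flip: exp_add)
    also have "\<dots> \<le> 1 * (y - x)"
    proof (rule mult_mono)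
      show "1 - exp (- (y - x)) \<le> y - x"
        using exp_ge_add_one_self[of "- (y - x)"] by linarith
    qed (use that in auto)
    finally show ?thesis using that by simp
  qed
  show ?thesis
    using *[of x y] *[of y x] assms by (cases "x \<le> y") (auto simp: abs_minus_commute)
qed

text \<open>Conditioning on a variable with finitely many values reduces to elementary conditional
  measures. Values of probability zero, at which \<open>uniform_measure\<close> is not a probability measure,
  contribute nothing to the sum.\<close>
lemma (in prob_space) finite_total_expectation:
  fixes f :: "'a \<Rightarrow> 'b::{banach, second_countable_topology}"
  assumes P[measurable]: "P \<in> M \<rightarrow>\<^sub>M count_space S" and S: "finite S"
    and f[measurable]: "f \<in> borel_measurable M"
    and int: "\<And>p. p \<in> S \<Longrightarrow> prob {\<omega>\<in>space M. P \<omega> = p} > 0 \<Longrightarrow>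
      integrable (uniform_measure M {\<omega>\<in>space M. P \<omega> = p}) f"
  shows "integrable M f"
    and "expectation f = (\<Sum>p\<in>S. prob {\<omega>\<in>space M. P \<omega> = p} *\<^sub>R
      integral\<^sup>L (uniform_measure M {\<omega>\<in>space M. P \<omega> = p}) f)"
proof -
  define E where "E p = {\<omega>\<in>space M. P \<omega> = p}" for p
  have E_eq: "E p = P -` {p} \<inter> space M" for p by (auto simp: E_def)
  have E[measurable]: "E p \<in> events" if "p \<in> S" for p
    unfolding E_eq using that by (intro measurable_sets[OF P]) auto
  have *: "integrable M (\<lambda>\<omega>. indicator (E p) \<omega> *\<^sub>R f \<omega>) \<and>
      (\<integral>\<omega>. indicator (E p) \<omega> *\<^sub>R f \<omega> \<partial>M) = prob (E p) *\<^sub>R integral\<^sup>L (uniform_measure M (E p)) f"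
    if p: "p \<in> S" for p
  proof (cases "prob (E p) > 0")
    case False
    then have "prob (E p) = 0" using measure_nonneg[of M "E p"] by linarith
    then have "AE \<omega> in M. \<omega> \<notin> E p"
      using E[OF p] by (simp add: AE_iff_measurable[OF E[OF p]] emeasure_eq_measure
          prob_eq_0 )
    then have ae: "AE \<omega> in M. indicator (E p) \<omega> *\<^sub>R f \<omega> = 0"
      by (rule AE_mp) (auto intro!: AE_I2)
    have "integrable M (\<lambda>\<omega>. indicator (E p) \<omega> *\<^sub>R f \<omega>)"
      using ae p by (subst integrable_cong_AE[where g="\<lambda>_. 0"]) auto
    moreover have "(\<integral>\<omega>. indicator (E p) \<omega> *\<^sub>R f \<omega> \<partial>M) = 0"
      using ae p by (subst integral_cong_AE[where g="\<lambda>_. 0"]) auto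
    ultimately show ?thesis using \<open>prob (E p) = 0\<close> by simp
  next
    case True
    have dens: "uniform_measure M (E p) = density M (\<lambda>\<omega>. ennreal (indicator (E p) \<omega> / prob (E p)))"
      unfolding uniform_measure_def using True
      by (intro arg_cong2[where f=density] refl ext)
        (auto simp: emeasure_eq_measure divide_ennreal[symmetric] indicator_def ennreal_1[symmetric] simp del: ennreal_1)
    have int_dens: "integrable M (\<lambda>\<omega>. (indicator (E p) \<omega> / prob (E p)) *\<^sub>R f \<omega>)"
      using int[OF p] True p unfolding E_def[symmetric] dens
      by (subst (asm) integrable_density) auto
    have cancel: "prob (E p) *\<^sub>R ((indicator (E p) \<omega> / prob (E p)) *\<^sub>R f \<omega>) = indicator (E p) \<omega> *\<^sub>R f \<omega>" for \<omega>
      using True by simp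
    have "integral\<^sup>L (uniform_measure M (E p)) f =
        (\<integral>\<omega>. (indicator (E p) \<omega> / prob (E p)) *\<^sub>R f \<omega> \<partial>M)"
      unfolding dens using p by (subst integral_density) auto
    then show ?thesis
      using integrable_scaleR_right[OF int_dens, of "prob (E p)"]
        integral_scaleR_right[of M "prob (E p)" "\<lambda>\<omega>. (indicator (E p) \<omega> / prob (E p)) *\<^sub>R f \<omega>"]
      unfolding cancel by simp
  qed
  have sum: "f \<omega> = (\<Sum>p\<in>S. indicator (E p) \<omega> *\<^sub>R f \<omega>)" if "\<omega> \<in> space M" for \<omega>
  proof -
    have "P \<omega> \<in> S" using measurable_space[OF P that] by simp
    have "(\<Sum>p\<in>S. indicator (E p) \<omega> *\<^sub>R f \<omega>) = (\<Sum>p\<in>S. if p = P \<omega> then f \<omega> else 0)"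
      using that by (intro sum.cong) (auto simp: E_def indicator_def)
    then show ?thesis using S \<open>P \<omega> \<in> S\<close> by simp
  qed
  have "integrable M (\<lambda>\<omega>. \<Sum>p\<in>S. indicator (E p) \<omega> *\<^sub>R f \<omega>)"
    using * by (intro Bochner_Integration.integrable_sum) auto
  then show "integrable M f"
    by (rule Bochner_Integration.integrable_cong[THEN iffD2, rotated -1]) (auto intro: sum)
  have "expectation f = (\<integral>\<omega>. (\<Sum>p\<in>S. indicator (E p) \<omega> *\<^sub>R f \<omega>) \<partial>M)"
    by (intro Bochner_Integration.integral_cong refl sum)
  also have "\<dots> = (\<Sum>p\<in>S. prob (E p) *\<^sub>R integral\<^sup>L (uniform_measure M (E p)) f)"
    using * by (subst Bochner_Integration.integral_sum) auto
  finally show "expectation f = (\<Sum>p\<in>S. prob {\<omega>\<in>space M. P \<omega> = p} *\<^sub>R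
      integral\<^sup>L (uniform_measure M {\<omega>\<in>space M. P \<omega> = p}) f)"
    unfolding E_def .
qed

text \<open>Orthogonality: the mixed terms vanish as the summands are independent and centred.\<close>
lemma (in prob_space) second_moment_sum_indep:
  fixes X :: "'i \<Rightarrow> 'a \<Rightarrow> real"
  assumes "finite I" "indep_vars (\<lambda>_. borel) X I"
    and "\<And>i. i \<in> I \<Longrightarrow> integrable M (\<lambda>\<omega>. (X i \<omega>)\<^sup>2)"
    and "\<And>i. i \<in> I \<Longrightarrow> expectation (X i) = 0"
  shows "integrable M (\<lambda>\<omega>. (\<Sum>i\<in>I. X i \<omega>)\<^sup>2) \<and>
    expectation (\<lambda>\<omega>. (\<Sum>i\<in>I. X i \<omega>)\<^sup>2) = (\<Sum>i\<in>I. expectation (\<lambda>\<omega>. (X i \<omega>)\<^sup>2))"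
  using assms
proof (induction I rule: finite_induct)
  case empty
  then show ?case by simp
next
  case (insert x I)
  have meas[measurable]: "X i \<in> borel_measurable M" if "i \<in> insert x I" for i
    using insert.prems(1) that by (auto simp: indep_vars_def2)
  have int: "integrable M (X i)" if "i \<in> insert x I" for i
    by (rule square_integrable_imp_integrable[OF meas[OF that] insert.prems(2)[OF that]])
  have ind: "indep_var borel (X x) borel (\<lambda>\<omega>. \<Sum>i\<in>I. X i \<omega>)"
    using insert by (intro indep_vars_sum) auto
  have IH: "integrable M (\<lambda>\<omega>. (\<Sum>i\<in>I. X i \<omega>)\<^sup>2)"
    "expectation (\<lambda>\<omega>. (\<Sum>i\<in>I. X i \<omega>)\<^sup>2) = (\<Sum>i\<in>I. expectation (\<lambda>\<omega>. (X i \<omega>)\<^sup>2))"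
    using insert.IH insert.prems indep_vars_subset[OF insert.prems(1)] by auto
  have cross: "integrable M (\<lambda>\<omega>. X x \<omega> * (\<Sum>i\<in>I. X i \<omega>))"
    "expectation (\<lambda>\<omega>. X x \<omega> * (\<Sum>i\<in>I. X i \<omega>)) = 0"
    using indep_var_integrable[OF ind] indep_var_lebesgue_integral[OF ind] int insert.prems(3)
    by auto
  have sq: "(\<lambda>\<omega>. (\<Sum>i\<in>insert x I. X i \<omega>)\<^sup>2) =
      (\<lambda>\<omega>. (X x \<omega>)\<^sup>2 + 2 * (X x \<omega> * (\<Sum>i\<in>I. X i \<omega>)) + (\<Sum>i\<in>I. X i \<omega>)\<^sup>2)"
    using insert.hyps by (simp add: power2_sum algebra_simps)
  show ?case
    unfolding sq using cross IH insert.prems(2) insert.hyps by simp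
qed

text \<open>If \<open>\<Sum>c\<close> is nonnegative, then an upper bound for each \<open>c i\<close> controls the absolute values as
  well: \<open>\<bar>c i\<bar> \<le> 2 F i - c i\<close> regardless of the sign of \<open>c i\<close>.\<close>
lemma sum_abs_le_twice_sum_bound:
  fixes c F :: "'i \<Rightarrow> real"
  assumes "\<And>i. i \<in> I \<Longrightarrow> c i \<le> F i" "\<And>i. i \<in> I \<Longrightarrow> 0 \<le> F i" "0 \<le> (\<Sum>i\<in>I. c i)"
  shows "(\<Sum>i\<in>I. \<bar>c i\<bar>) \<le> 2 * (\<Sum>i\<in>I. F i)"
proof -
  have "(\<Sum>i\<in>I. \<bar>c i\<bar>) \<le> (\<Sum>i\<in>I. 2 * F i - c i)"
    using assms(1,2) by (intro sum_mono) (auto simp: abs_if intro: add_mono)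
  also have "\<dots> = 2 * (\<Sum>i\<in>I. F i) - (\<Sum>i\<in>I. c i)"
    by (simp add: sum_subtractf sum_distrib_left)
  finally show ?thesis using assms(3) by simp
qed

lemma (in prob_space) expectation_abs_le_sqrt:
  fixes X :: "'a \<Rightarrow> real"
  assumes [measurable]: "X \<in> borel_measurable M" and int2: "integrable M (\<lambda>\<omega>. (X \<omega>)\<^sup>2)"
  shows "expectation (\<lambda>\<omega>. \<bar>X \<omega>\<bar>) \<le> sqrt (expectation (\<lambda>\<omega>. (X \<omega>)\<^sup>2))"
proof -
  have "integrable M X"
    by (rule square_integrable_imp_integrable[OF assms])
  then have "variance (\<lambda>\<omega>. \<bar>X \<omega>\<bar>) = expectation (\<lambda>\<omega>. (X \<omega>)\<^sup>2) - (expectation (\<lambda>\<omega>. \<bar>X \<omega>\<bar>))\<^sup>2"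
    using int2 by (subst variance_eq) auto
  then have "(expectation (\<lambda>\<omega>. \<bar>X \<omega>\<bar>))\<^sup>2 \<le> expectation (\<lambda>\<omega>. (X \<omega>)\<^sup>2)"
    using variance_positive[of "\<lambda>\<omega>. \<bar>X \<omega>\<bar>"] by simp
  then show ?thesis by (rule real_le_rsqrt)
qed

section \<open>Characteristic function of a sum of coloured weights\<close>

locale centred_colour = prob_space N for N :: "'y measure" +
  fixes Y :: "'y \<Rightarrow> real"
  assumes Y_meas[measurable]: "Y \<in> borel_measurable N"
    and fourth_moment: "integrable N (\<lambda>x. Y x ^ 4)"
    and mean_zero: "expectation Y = 0"
begin

definition second_moment :: real where "second_moment = expectation (\<lambda>x. (Y x)\<^sup>2)"

definition abs_third_moment :: real where "abs_third_moment = expectation (\<lambda>x. \<bar>Y x\<bar> ^ 3)"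

text \<open>The constant in front of \<open>\<bar>u\<bar>\<^sup>3\<close> in the distance between the characteristic function of \<open>Y\<close>
  and that of the centred Gaussian law with the same variance.\<close>
definition gaussian_error :: real where
  "gaussian_error = abs_third_moment / 6 + (sqrt second_moment) ^ 3"

lemma integrable_power_Y:
  assumes "n \<le> 4"
  shows "integrable N (\<lambda>x. \<bar>Y x\<bar> ^ n)"
proof (rule Bochner_Integration.integrable_bound)
  show "integrable N (\<lambda>x. 1 + Y x ^ 4)"
    using fourth_moment by simp
  \<comment> \<open>Lower powers are dominated by the fourth outside the unit interval and by \<open>1\<close> inside.\<close>
  have "\<bar>y\<bar> ^ n \<le> 1 + y ^ 4" for y :: real
  proof (cases "\<bar>y\<bar> \<le> 1")
    case True
    then have "\<bar>y\<bar> ^ n \<le> 1" by (intro power_le_one) auto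
    then show ?thesis by (simp add: add_increasing2)
  next
    case False
    then have "\<bar>y\<bar> ^ n \<le> \<bar>y\<bar> ^ 4" using assms by (intro power_increasing) auto
    then show ?thesis by simp
  qed
  then show "AE x in N. norm (\<bar>Y x\<bar> ^ n) \<le> norm (1 + Y x ^ 4)"
    by (auto intro: order_trans[OF _ abs_ge_self])
qed measurable

lemma integrable_Y: "integrable N Y" and integrable_Y2: "integrable N (\<lambda>x. (Y x)\<^sup>2)"
  and integrable_Y3: "integrable N (\<lambda>x. \<bar>Y x\<bar> ^ 3)"
  using integrable_power_Y[of 1] integrable_power_Y[of 2] integrable_power_Y[of 3]
  by (auto simp: integrable_abs_iff)

lemma second_moment_nonneg: "second_moment \<ge> 0"
  unfolding second_moment_def by simp

lemma gaussian_error_nonneg: "gaussian_error \<ge> 0"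
  unfolding gaussian_error_def abs_third_moment_def using second_moment_nonneg by simp

lemma second_moment_pos:
  assumes "expectation (\<lambda>x. Y x ^ 4) > 0"
  shows "second_moment > 0"
proof (rule ccontr)
  assume "\<not> second_moment > 0"
  then have "second_moment = 0" using second_moment_nonneg by simp
  then have "AE x in N. (Y x)\<^sup>2 = 0"
    unfolding second_moment_def using integrable_Y2
    by (subst (asm) integral_nonneg_eq_0_iff_AE) auto
  then have "expectation (\<lambda>x. Y x ^ 4) = expectation (\<lambda>_. 0)"
    by (intro integral_cong_AE) auto
  with assms show False by simp
qed

text \<open>Both characteristic functions agree with \<open>1 - \<sigma>\<^sup>2 u\<^sup>2 / 2\<close>, where \<open>\<sigma>\<^sup>2\<close> is the second
  moment of \<open>Y\<close>, up to a term of third order.\<close>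
lemma char_colour_approx:
  "cmod (char (distr N borel Y) u - exp (- (second_moment * u\<^sup>2 / 2))) \<le> gaussian_error * \<bar>u\<bar> ^ 3"
proof -
  have "cmod (char (distr N borel Y) u - (1 - u\<^sup>2 * second_moment / 2))
      \<le> u\<^sup>2 / 6 * expectation (\<lambda>x. min (6 * (Y x)\<^sup>2) (\<bar>u\<bar> * \<bar>Y x\<bar> ^ 3))"
    using integrable_Y integrable_Y2 mean_zero
    by (intro char_approx3') (auto simp: second_moment_def)
  also have "\<dots> \<le> u\<^sup>2 / 6 * expectation (\<lambda>x. \<bar>u\<bar> * \<bar>Y x\<bar> ^ 3)"
    using integrable_Y2 integrable_Y3
    by (intro mult_left_mono integral_mono integrable_min integrable_mult_right) auto
  also have "\<dots> = abs_third_moment / 6 * \<bar>u\<bar> ^ 3"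
    unfolding abs_third_moment_def by (simp add: power3_eq_cube power2_eq_square)
  finally have 1: "cmod (char (distr N borel Y) u - (1 - u\<^sup>2 * second_moment / 2))
      \<le> abs_third_moment / 6 * \<bar>u\<bar> ^ 3" .
  define s where "s = sqrt second_moment"
  have s: "s \<ge> 0" "s\<^sup>2 = second_moment"
    using second_moment_nonneg by (auto simp: s_def)
  \<comment> \<open>The scaling is chosen such that \<open>v\<^sup>2\<close> is the exponent \<open>\<sigma>\<^sup>2 u\<^sup>2 / 2\<close> of the Gaussian.\<close>
  define v where "v = s * u / sqrt 2"
  have v2: "v\<^sup>2 = second_moment * u\<^sup>2 / 2"
    using s by (simp add: v_def power_divide power_mult_distrib)
  have "\<bar>v\<bar> \<le> \<bar>s * u\<bar>"
    using mult_left_mono[of 1 "sqrt 2" "\<bar>s * u\<bar>"] by (simp add: v_def abs_divide divide_le_eq)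
  then have "\<bar>v\<bar> ^ 3 \<le> \<bar>s * u\<bar> ^ 3" by (intro power_mono) auto
  also have "\<dots> = s ^ 3 * \<bar>u\<bar> ^ 3" using s by (simp add: abs_mult power_mult_distrib)
  finally have "\<bar>exp (- (second_moment * u\<^sup>2 / 2)) - (1 - u\<^sup>2 * second_moment / 2)\<bar> \<le> s ^ 3 * \<bar>u\<bar> ^ 3"
    using exp_minus_square_approx[of v] unfolding v2 by (simp add: mult.commute)
  then have 2: "cmod (complex_of_real (exp (- (second_moment * u\<^sup>2 / 2))) - (1 - u\<^sup>2 * second_moment / 2)) \<le> s ^ 3 * \<bar>u\<bar> ^ 3"
    unfolding of_real_diff[symmetric] norm_of_real by simp
  show ?thesis
    using norm_triangle_le_diff[of _ _ "abs_third_moment / 6 * \<bar>u\<bar> ^ 3 + s ^ 3 * \<bar>u\<bar> ^ 3", OF add_mono[OF 1 2]]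
    by (simp add: gaussian_error_def s_def distrib_right)
qed

text \<open>Lindeberg's argument in Fourier form: by independence the two characteristic functions are
  products with factors in the unit disc, and the distance of such products is at most the sum of the
  distances of the factors.\<close>
lemma weighted_colour_sum_char:
  fixes Q :: "'a measure" and X :: "'b \<Rightarrow> 'a \<Rightarrow> real" and u :: "'b \<Rightarrow> real"
  assumes "prob_space Q" "prob_space.indep_vars Q (\<lambda>_. borel) X p"
    and "\<And>B. B \<in> p \<Longrightarrow> distr Q borel (X B) = distr N borel Y"
  shows "cmod (char (distr Q borel (\<lambda>\<omega>. \<Sum>B\<in>p. u B * X B \<omega>)) t
      - exp (- (t\<^sup>2 * second_moment / 2 * (\<Sum>B\<in>p. (u B)\<^sup>2))))
    \<le> gaussian_error * \<bar>t\<bar> ^ 3 * (\<Sum>B\<in>p. \<bar>u B\<bar> ^ 3)"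
proof (cases "finite p")
  case fin: True
  interpret Q: prob_space Q by fact
  have meas[measurable]: "X B \<in> borel_measurable Q" if "B \<in> p" for B
    using assms(2) that by (auto simp: Q.indep_vars_def2)
  have "Q.indep_vars (\<lambda>_. borel) (\<lambda>B \<omega>. u B * X B \<omega>) p"
    by (rule Q.indep_vars_compose2[OF assms(2)]) simp
  then have "char (distr Q borel (\<lambda>\<omega>. \<Sum>B\<in>p. u B * X B \<omega>)) t
      = (\<Prod>B\<in>p. char (distr Q borel (\<lambda>\<omega>. u B * X B \<omega>)) t)"
    by (rule Q.char_distr_sum)
  also have "\<dots> = (\<Prod>B\<in>p. char (distr N borel Y) (t * u B))"
  proof (intro prod.cong refl)
    fix B assume B: "B \<in> p"
    have "char (distr Q borel (\<lambda>\<omega>. u B * X B \<omega>)) t = char (distr Q borel (X B)) (t * u B)"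
      using B by (simp add: char_def integral_distr mult.assoc)
    then show "char (distr Q borel (\<lambda>\<omega>. u B * X B \<omega>)) t = char (distr N borel Y) (t * u B)"
      using assms(3)[OF B] by simp
  qed
  finally have 1: "char (distr Q borel (\<lambda>\<omega>. \<Sum>B\<in>p. u B * X B \<omega>)) t =
      (\<Prod>B\<in>p. char (distr N borel Y) (t * u B))" .
  have "t\<^sup>2 * second_moment / 2 * (\<Sum>B\<in>p. (u B)\<^sup>2) = (\<Sum>B\<in>p. second_moment * (t * u B)\<^sup>2 / 2)"
    by (simp add: sum_distrib_left power_mult_distrib algebra_simps)
  then have 2: "complex_of_real (exp (- (t\<^sup>2 * second_moment / 2 * (\<Sum>B\<in>p. (u B)\<^sup>2)))) =
      (\<Prod>B\<in>p. complex_of_real (exp (- (second_moment * (t * u B)\<^sup>2 / 2))))"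
    using fin by (simp add: exp_sum sum_negf[symmetric])
  interpret distr_Y: real_distribution "distr N borel Y"
    by (rule real_distribution_distr) simp
  have "cmod (char (distr Q borel (\<lambda>\<omega>. \<Sum>B\<in>p. u B * X B \<omega>)) t
      - exp (- (t\<^sup>2 * second_moment / 2 * (\<Sum>B\<in>p. (u B)\<^sup>2))))
    \<le> (\<Sum>B\<in>p. cmod (char (distr N borel Y) (t * u B) - exp (- (second_moment * (t * u B)\<^sup>2 / 2))))"
    unfolding 1 2 using second_moment_nonneg
    by (intro norm_prod_diff) (auto simp: distr_Y.cmod_char_le_1)
  also have "\<dots> \<le> (\<Sum>B\<in>p. gaussian_error * \<bar>t * u B\<bar> ^ 3)"
    by (intro sum_mono char_colour_approx)
  finally show ?thesis
    by (simp add: sum_distrib_left abs_mult power_mult_distrib mult.assoc)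
next
  case False
  then show ?thesis
    by (simp add: char_def integral_distr prob_space.prob_space[OF assms(1)])
qed

end

section \<open>Moments and characteristic function given the partition\<close>

locale coloured_partition = prob_space M + colour: centred_colour N Y
  for M :: "'w measure" and N :: "'y measure" and Y :: "'y \<Rightarrow> real" +
  fixes m :: nat and P :: "'w \<Rightarrow> nat set set" and C :: "nat set \<Rightarrow> 'w \<Rightarrow> real"
  assumes iid: "iid_coloured_partition M m P C N Y"
begin

abbreviation cond :: "nat set set \<Rightarrow> 'w measure" where
  "cond p \<equiv> uniform_measure M {\<omega>\<in>space M. P \<omega> = p}"

abbreviation partitions :: "nat set set set" where
  "partitions \<equiv> {p. partition_on {1..m} p}"

definition linear_form :: "(nat \<Rightarrow> real) \<Rightarrow> 'w \<Rightarrow> real" where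
  "linear_form a \<omega> = (\<Sum>i=1..m. a i * colour_at P C i \<omega>)"

definition weight_square :: "(nat \<Rightarrow> real) \<Rightarrow> nat set set \<Rightarrow> real" where
  "weight_square a p = (\<Sum>B\<in>p. (\<Sum>i\<in>B. a i)\<^sup>2)"

definition pair_prob :: "nat \<Rightarrow> nat \<Rightarrow> real" where
  "pair_prob i j = prob {\<omega>\<in>space M. same_part (P \<omega>) i j}"

definition triple_prob :: "nat \<Rightarrow> nat \<Rightarrow> nat \<Rightarrow> real" where
  "triple_prob i j k = prob {\<omega>\<in>space M. same_part (P \<omega>) i j \<and> same_part (P \<omega>) j k}"

definition quadruple_prob :: "nat \<Rightarrow> nat \<Rightarrow> nat \<Rightarrow> nat \<Rightarrow> real" where
  "quadruple_prob i j k l =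
    prob {\<omega>\<in>space M. same_part (P \<omega>) i j \<and> same_part (P \<omega>) j k \<and> same_part (P \<omega>) k l}"

lemma P_meas[measurable]: "P \<in> M \<rightarrow>\<^sub>M count_space partitions"
  using iid by (simp add: iid_coloured_partition_def partition_space_def)

lemma P_partition: "\<omega> \<in> space M \<Longrightarrow> partition_on {1..m} (P \<omega>)"
  using measurable_space[OF P_meas] by simp

lemma finite_partitions: "finite partitions"
  by (rule finitely_many_partition_on) simp

lemma finite_partition: "partition_on {1..m} p \<Longrightarrow> finite p"
  by (rule finite_elements) simp_all

lemma P_comp_meas[measurable]: "(\<lambda>\<omega>. g (P \<omega>)) \<in> M \<rightarrow>\<^sub>M count_space UNIV"
  by (rule measurable_compose[OF P_meas]) simp

lemma P_comp_borel[measurable]: "(\<lambda>\<omega>. g (P \<omega>)) \<in> borel_measurable M"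
  by (rule measurable_compose[OF P_meas]) simp

lemma P_event[measurable]: "{\<omega>\<in>space M. g (P \<omega>)} \<in> events"
proof -
  have "{\<omega>\<in>space M. g (P \<omega>)} = (\<lambda>\<omega>. g (P \<omega>)) -` {True} \<inter> space M" by auto
  then show ?thesis using measurable_sets[OF P_comp_meas, of "{True}" g] by simp
qed

lemma integrable_P_comp:
  fixes g :: "nat set set \<Rightarrow> 'b::{banach, second_countable_topology}"
  shows "integrable M (\<lambda>\<omega>. g (P \<omega>))"
proof (rule integrable_const_bound[where B="\<Sum>p\<in>partitions. norm (g p)"])
  have "norm (g (P \<omega>)) \<le> (\<Sum>p\<in>partitions. norm (g p))" if "\<omega> \<in> space M" for \<omega>
    using that P_partition by (intro member_le_sum finite_partitions) auto
  then show "AE \<omega> in M. norm (g (P \<omega>)) \<le> (\<Sum>p\<in>partitions. norm (g p))" by simp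
qed simp

lemma expectation_of_bool_P:
  "expectation (\<lambda>\<omega>. of_bool (R (P \<omega>))) = prob {\<omega>\<in>space M. R (P \<omega>)}"
proof -
  have "expectation (\<lambda>\<omega>. of_bool (R (P \<omega>))) = expectation (indicator {\<omega>\<in>space M. R (P \<omega>)})"
    by (intro Bochner_Integration.integral_cong) (auto simp: indicator_def)
  also have "\<dots> = prob {\<omega>\<in>space M. R (P \<omega>)}"
    by (rule Bochner_Integration.integral_indicator[THEN trans]) (simp add: Int_absorb2)
  finally show ?thesis .
qed

lemma expectation_sum_P_comp:
  fixes g :: "'i \<Rightarrow> nat set set \<Rightarrow> 'b::{banach, second_countable_topology}"
  shows "expectation (\<lambda>\<omega>. \<Sum>i\<in>A. g i (P \<omega>)) = (\<Sum>i\<in>A. expectation (\<lambda>\<omega>. g i (P \<omega>)))"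
  by (rule Bochner_Integration.integral_sum) (rule integrable_P_comp)

lemma colour_meas[measurable]:
  assumes "i \<in> {1..m}"
  shows "colour_at P C i \<in> borel_measurable M"
  unfolding colour_at_def
proof (rule measurable_compose_countable'[OF _ P_meas countable_finite[OF finite_partitions],
      where f="\<lambda>p. C (part_of p i)"])
  fix p assume p: "p \<in> partitions"
  then have "part_of p i \<in> p" "i \<in> part_of p i"
    using part_of_mem[of "{1..m}" p i] assms by auto
  then have "part_of p i \<subseteq> {1..m}" "part_of p i \<noteq> {}"
    using p partition_onD1[of "{1..m}" p] by auto
  then show "C (part_of p i) \<in> borel_measurable M"
    using iid by (simp add: iid_coloured_partition_def)
qed

lemma linear_form_meas[measurable]: "linear_form a \<in> borel_measurable M"
  unfolding linear_form_def by measurable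

lemma cond_P_comp:
  fixes g :: "nat set set \<Rightarrow> 'b::{banach, second_countable_topology}"
  assumes "prob {\<omega>\<in>space M. P \<omega> = p} > 0"
  shows "integrable (cond p) (\<lambda>\<omega>. g (P \<omega>))" "integral\<^sup>L (cond p) (\<lambda>\<omega>. g (P \<omega>)) = g p"
proof -
  have "emeasure M {\<omega>\<in>space M. P \<omega> = p} \<noteq> 0" using assms by (simp add: emeasure_eq_measure)
  then interpret Q: prob_space "cond p"
    by (rule prob_space_uniform_measure) simp
  have const: "AE \<omega> in cond p. g (P \<omega>) = g p"
    by (rule AE_uniform_measureI[OF P_event]) simp
  then show "integrable (cond p) (\<lambda>\<omega>. g (P \<omega>))"
    by (subst integrable_cong_AE[where g="\<lambda>_. g p"]) simp_all
  have "integral\<^sup>L (cond p) (\<lambda>\<omega>. g (P \<omega>)) = integral\<^sup>L (cond p) (\<lambda>_. g p)"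
    using const by (intro integral_cong_AE) simp_all
  then show "integral\<^sup>L (cond p) (\<lambda>\<omega>. g (P \<omega>)) = g p" using Q.prob_space by simp
qed

text \<open>The law of total expectation. The function \<open>g\<close> is prescribed only on partitions of
  positive probability; this freedom is used in \<open>linear_form_char\<close>.\<close>
lemma total_expectation:
  fixes f :: "'w \<Rightarrow> 'b::{banach, second_countable_topology}"
  assumes "f \<in> borel_measurable M"
    and "\<And>p. partition_on {1..m} p \<Longrightarrow> prob {\<omega>\<in>space M. P \<omega> = p} > 0 \<Longrightarrow>
      integrable (cond p) f \<and> integral\<^sup>L (cond p) f = g p"
  shows "integrable M f" and "expectation f = expectation (\<lambda>\<omega>. g (P \<omega>))"
proof -
  show "integrable M f"
    by (rule finite_total_expectation[OF P_meas finite_partitions]) (use assms in auto)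
  have "expectation f = (\<Sum>p\<in>partitions. prob {\<omega>\<in>space M. P \<omega> = p} *\<^sub>R integral\<^sup>L (cond p) f)"
    by (rule finite_total_expectation[OF P_meas finite_partitions]) (use assms in auto)
  also have "\<dots> = (\<Sum>p\<in>partitions. prob {\<omega>\<in>space M. P \<omega> = p} *\<^sub>R integral\<^sup>L (cond p) (\<lambda>\<omega>. g (P \<omega>)))"
  proof (intro sum.cong refl)
    fix p assume p: "p \<in> partitions"
    show "prob {\<omega>\<in>space M. P \<omega> = p} *\<^sub>R integral\<^sup>L (cond p) f =
      prob {\<omega>\<in>space M. P \<omega> = p} *\<^sub>R integral\<^sup>L (cond p) (\<lambda>\<omega>. g (P \<omega>))"
    proof (cases "prob {\<omega>\<in>space M. P \<omega> = p} > 0")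
      case True
      then show ?thesis using assms(2) p cond_P_comp(2)[OF True, of g] by simp
    next
      case False
      then have "prob {\<omega>\<in>space M. P \<omega> = p} = 0" by (simp add: not_less measure_le_0_iff)
      then show ?thesis by simp
    qed
  qed
  also have "\<dots> = expectation (\<lambda>\<omega>. g (P \<omega>))"
    by (rule finite_total_expectation(2)[OF P_meas finite_partitions, symmetric])
      (auto intro: cond_P_comp)
  finally show "expectation f = expectation (\<lambda>\<omega>. g (P \<omega>))" .
qed

context
  fixes p assumes p: "partition_on {1..m} p" and pos: "prob {\<omega>\<in>space M. P \<omega> = p} > 0"
begin

lemma prob_space_cond: "prob_space (cond p)"
  using pos by (intro prob_space_uniform_measure) (simp_all add: emeasure_eq_measure)

interpretation Q: prob_space "cond p"
  by (rule prob_space_cond)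

lemma cond_indep: "Q.indep_vars (\<lambda>_. borel) C p"
  and cond_distr: "\<And>B. B \<in> p \<Longrightarrow> distr (cond p) borel (C B) = distr N borel Y"
  using iid pos by (auto simp: iid_coloured_partition_def Let_def)

lemma C_meas[measurable]: "B \<in> p \<Longrightarrow> C B \<in> borel_measurable M"
  using cond_indep by (auto simp: Q.indep_vars_def2)

text \<open>Grouping the indices by partition elements exhibits the linear form, on the event that the
  partition is \<open>p\<close>, as a sum of variables that are independent under the conditional law.\<close>
lemma linear_form_cond:
  "AE \<omega> in cond p. linear_form a \<omega> = (\<Sum>B\<in>p. (\<Sum>i\<in>B. a i) * C B \<omega>)"
proof (rule AE_uniform_measureI[OF P_event], rule AE_I2, intro impI)
  fix \<omega> assume "\<omega> \<in> {\<omega> \<in> space M. P \<omega> = p}"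
  then have "linear_form a \<omega> = (\<Sum>i=1..m. a i * C (part_of p i) \<omega>)"
    by (simp add: linear_form_def colour_at_def)
  also have "\<dots> = (\<Sum>B\<in>p. \<Sum>i\<in>B. a i * C B \<omega>)"
    using p by (intro sum_over_blocks[symmetric]) auto
  finally show "linear_form a \<omega> = (\<Sum>B\<in>p. (\<Sum>i\<in>B. a i) * C B \<omega>)"
    by (simp add: sum_distrib_right)
qed

lemma cond_moments:
  assumes B: "B \<in> p"
  shows "integrable (cond p) (C B)" "integral\<^sup>L (cond p) (C B) = 0"
    "integrable (cond p) (\<lambda>\<omega>. (C B \<omega>)\<^sup>2)"
    "integral\<^sup>L (cond p) (\<lambda>\<omega>. (C B \<omega>)\<^sup>2) = colour.second_moment"
proof -
  have [measurable]: "C B \<in> borel_measurable M" by (rule C_meas[OF B])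
  have "integrable (distr (cond p) borel (C B)) (\<lambda>x. x)"
    "integral\<^sup>L (distr (cond p) borel (C B)) (\<lambda>x. x) = 0"
    "integrable (distr (cond p) borel (C B)) (\<lambda>x. x\<^sup>2)"
    "integral\<^sup>L (distr (cond p) borel (C B)) (\<lambda>x. x\<^sup>2) = colour.second_moment"
    unfolding cond_distr[OF B]
    using colour.integrable_Y colour.integrable_Y2 colour.mean_zero
    by (simp_all add: integrable_distr_eq integral_distr colour.second_moment_def)
  then show "integrable (cond p) (C B)" "integral\<^sup>L (cond p) (C B) = 0"
    "integrable (cond p) (\<lambda>\<omega>. (C B \<omega>)\<^sup>2)"
    "integral\<^sup>L (cond p) (\<lambda>\<omega>. (C B \<omega>)\<^sup>2) = colour.second_moment"
    by (simp_all add: integrable_distr_eq integral_distr)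
qed

lemma linear_form_cond_mean:
  "integrable (cond p) (linear_form a) \<and> integral\<^sup>L (cond p) (linear_form a) = 0"
proof -
  have "integrable (cond p) (\<lambda>\<omega>. \<Sum>B\<in>p. (\<Sum>i\<in>B. a i) * C B \<omega>)"
    using cond_moments by (intro Bochner_Integration.integrable_sum integrable_mult_right) auto
  moreover have "integral\<^sup>L (cond p) (\<lambda>\<omega>. \<Sum>B\<in>p. (\<Sum>i\<in>B. a i) * C B \<omega>) = 0"
    using cond_moments by (subst Bochner_Integration.integral_sum) auto
  moreover have "integral\<^sup>L (cond p) (linear_form a) =
      integral\<^sup>L (cond p) (\<lambda>\<omega>. \<Sum>B\<in>p. (\<Sum>i\<in>B. a i) * C B \<omega>)"
    using linear_form_cond by (intro integral_cong_AE) simp_all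
  ultimately show ?thesis
    using linear_form_cond by (subst integrable_cong_AE) simp_all
qed

lemma linear_form_cond_variance:
  "integrable (cond p) (\<lambda>\<omega>. (linear_form a \<omega>)\<^sup>2) \<and>
   integral\<^sup>L (cond p) (\<lambda>\<omega>. (linear_form a \<omega>)\<^sup>2) = colour.second_moment * weight_square a p"
proof -
  let ?w = "\<lambda>B. \<Sum>i\<in>B. a i"
  have ind: "Q.indep_vars (\<lambda>_. borel) (\<lambda>B \<omega>. ?w B * C B \<omega>) p"
    by (rule Q.indep_vars_compose2[OF cond_indep]) simp
  have sq: "integrable (cond p) (\<lambda>\<omega>. (\<Sum>B\<in>p. ?w B * C B \<omega>)\<^sup>2) \<and>
      integral\<^sup>L (cond p) (\<lambda>\<omega>. (\<Sum>B\<in>p. ?w B * C B \<omega>)\<^sup>2) =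
      (\<Sum>B\<in>p. integral\<^sup>L (cond p) (\<lambda>\<omega>. (?w B * C B \<omega>)\<^sup>2))"
    using cond_moments
    by (intro Q.second_moment_sum_indep[OF finite_partition[OF p] ind]) (auto simp: power_mult_distrib)
  moreover have "(\<Sum>B\<in>p. integral\<^sup>L (cond p) (\<lambda>\<omega>. (?w B * C B \<omega>)\<^sup>2)) =
      colour.second_moment * weight_square a p"
    using cond_moments
    unfolding weight_square_def sum_distrib_left power_mult_distrib
    by (intro sum.cong refl) (simp add: mult.commute)
  moreover
  have ae: "AE \<omega> in cond p. (linear_form a \<omega>)\<^sup>2 = (\<Sum>B\<in>p. ?w B * C B \<omega>)\<^sup>2"
    using linear_form_cond[of a] by (rule AE_mp) simp
  have "integral\<^sup>L (cond p) (\<lambda>\<omega>. (linear_form a \<omega>)\<^sup>2) =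
      integral\<^sup>L (cond p) (\<lambda>\<omega>. (\<Sum>B\<in>p. ?w B * C B \<omega>)\<^sup>2)"
    by (rule integral_cong_AE[OF _ _ ae]) simp_all
  moreover have "integrable (cond p) (\<lambda>\<omega>. (linear_form a \<omega>)\<^sup>2)"
    by (rule integrable_cong_AE[THEN iffD2, OF _ _ ae conjunct1[OF sq]]) simp_all
  ultimately show ?thesis using sq by (simp only:)
qed

lemma linear_form_cond_char:
  "cmod (integral\<^sup>L (cond p) (\<lambda>\<omega>. iexp (t * linear_form a \<omega>))
      - exp (- (t\<^sup>2 * colour.second_moment / 2 * weight_square a p)))
    \<le> colour.gaussian_error * \<bar>t\<bar> ^ 3 * (\<Sum>B\<in>p. \<bar>\<Sum>i\<in>B. a i\<bar> ^ 3)"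
proof -
  have "AE \<omega> in cond p. iexp (t * linear_form a \<omega>) = iexp (t * (\<Sum>B\<in>p. (\<Sum>i\<in>B. a i) * C B \<omega>))"
    using linear_form_cond[of a] by (rule AE_mp) simp
  then have "integral\<^sup>L (cond p) (\<lambda>\<omega>. iexp (t * linear_form a \<omega>)) =
      char (distr (cond p) borel (\<lambda>\<omega>. \<Sum>B\<in>p. (\<Sum>i\<in>B. a i) * C B \<omega>)) t"
    unfolding char_def by (subst integral_distr) (auto intro!: integral_cong_AE)
  then show ?thesis
    using colour.weighted_colour_sum_char[OF prob_space_cond cond_indep cond_distr, of "\<lambda>B. \<Sum>i\<in>B. a i" t]
    by (simp add: weight_square_def)
qed

end

lemma linear_form_mean: "integrable M (linear_form a)" "expectation (linear_form a) = 0"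
  using total_expectation[OF linear_form_meas, of a "\<lambda>_. 0"] linear_form_cond_mean by simp_all

lemma linear_form_second_moment:
  "integrable M (\<lambda>\<omega>. (linear_form a \<omega>)\<^sup>2)"
  "expectation (\<lambda>\<omega>. (linear_form a \<omega>)\<^sup>2) =
    colour.second_moment * expectation (\<lambda>\<omega>. weight_square a (P \<omega>))"
  using total_expectation[of "\<lambda>\<omega>. (linear_form a \<omega>)\<^sup>2" "\<lambda>p. colour.second_moment * weight_square a p"]
    linear_form_cond_variance by simp_all

lemma weight_square_eq:
  "partition_on {1..m} p \<Longrightarrow>
    weight_square a p = (\<Sum>i=1..m. \<Sum>j=1..m. a i * a j * of_bool (same_part p i j))"
  unfolding weight_square_def by (rule sum_squared_block_weights) auto

lemma expectation_weight_square:
  "expectation (\<lambda>\<omega>. weight_square a (P \<omega>)) = (\<Sum>i=1..m. \<Sum>j=1..m. a i * a j * pair_prob i j)"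
proof -
  have "expectation (\<lambda>\<omega>. weight_square a (P \<omega>)) =
      expectation (\<lambda>\<omega>. \<Sum>i=1..m. \<Sum>j=1..m. a i * a j * of_bool (same_part (P \<omega>) i j))"
    by (intro Bochner_Integration.integral_cong refl weight_square_eq P_partition)
  also have "\<dots> = (\<Sum>i=1..m. \<Sum>j=1..m. a i * a j * expectation (\<lambda>\<omega>. of_bool (same_part (P \<omega>) i j)))"
    unfolding expectation_sum_P_comp[of "\<lambda>i p. \<Sum>j=1..m. a i * a j * of_bool (same_part p i j)"]
      expectation_sum_P_comp[of "\<lambda>j p. a i * a j * of_bool (same_part p i j)" for i]
      integral_mult_right_zero ..
  finally show ?thesis
    unfolding pair_prob_def expectation_of_bool_P[of "\<lambda>p. same_part p i j" for i j] .
qed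

lemma expectation_block_cubes:
  "expectation (\<lambda>\<omega>. \<Sum>B\<in>P \<omega>. real (card B) ^ 3) =
    (\<Sum>i=1..m. \<Sum>j=1..m. \<Sum>k=1..m. triple_prob i j k)"
proof -
  have "expectation (\<lambda>\<omega>. \<Sum>B\<in>P \<omega>. real (card B) ^ 3) =
      expectation (\<lambda>\<omega>. \<Sum>i=1..m. \<Sum>j=1..m. \<Sum>k=1..m.
        of_bool (same_part (P \<omega>) i j \<and> same_part (P \<omega>) j k))"
    by (intro Bochner_Integration.integral_cong refl sum_cubed_block_cards P_partition) auto
  also have "\<dots> = (\<Sum>i=1..m. \<Sum>j=1..m. \<Sum>k=1..m.
      expectation (\<lambda>\<omega>. of_bool (same_part (P \<omega>) i j \<and> same_part (P \<omega>) j k)))"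
    unfolding expectation_sum_P_comp[of "\<lambda>i p. \<Sum>j=1..m. \<Sum>k=1..m. of_bool (same_part p i j \<and> same_part p j k)"]
      expectation_sum_P_comp[of "\<lambda>j p. \<Sum>k=1..m. of_bool (same_part p i j \<and> same_part p j k)" for i]
      expectation_sum_P_comp[of "\<lambda>k p. of_bool (same_part p i j \<and> same_part p j k)" for i j] ..
  finally show ?thesis
    using expectation_of_bool_P[of "\<lambda>p. same_part p i j \<and> same_part p j k" for i j k]
    by (simp add: triple_prob_def del: of_bool_conj)
qed

section \<open>Concentration of the conditional variance\<close>

definition pair_covariances_dominated :: bool where
  "pair_covariances_dominated \<longleftrightarrow> (\<forall>i\<in>{1..m}. \<forall>j\<in>{1..m}. \<forall>k\<in>{1..m}. \<forall>l\<in>{1..m}.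
    covariance M (\<lambda>\<omega>. of_bool (same_part (P \<omega>) i j)) (\<lambda>\<omega>. of_bool (same_part (P \<omega>) k l))
      \<le> quadruple_prob i j k l)"

lemma weight_square_variance_expansion:
  "variance (\<lambda>\<omega>. weight_square a (P \<omega>)) =
    (\<Sum>((i, j), (k, l)) \<in> ({1..m} \<times> {1..m}) \<times> ({1..m} \<times> {1..m}). a i * a j * (a k * a l) *
      covariance M (\<lambda>\<omega>. of_bool (same_part (P \<omega>) i j)) (\<lambda>\<omega>. of_bool (same_part (P \<omega>) k l)))"
proof -
  let ?I = "{1..m} \<times> {1..m}"
  define X :: "nat \<times> nat \<Rightarrow> nat set set \<Rightarrow> real"
    where "X e p = of_bool (same_part p (fst e) (snd e))" for e p
  define D where "D e p = X e p - expectation (\<lambda>\<omega>. X e (P \<omega>))" for e p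
  define \<alpha> where "\<alpha> e = a (fst e) * a (snd e)" for e
  have W: "weight_square a (P \<omega>) = (\<Sum>e\<in>?I. \<alpha> e * X e (P \<omega>))" if "\<omega> \<in> space M" for \<omega>
    unfolding weight_square_eq[OF P_partition[OF that]] sum.cartesian_product
    by (simp add: X_def \<alpha>_def case_prod_unfold)
  have "expectation (\<lambda>\<omega>. weight_square a (P \<omega>)) = expectation (\<lambda>\<omega>. \<Sum>e\<in>?I. \<alpha> e * X e (P \<omega>))"
    by (intro Bochner_Integration.integral_cong refl W)
  also have "\<dots> = (\<Sum>e\<in>?I. \<alpha> e * expectation (\<lambda>\<omega>. X e (P \<omega>)))"
    unfolding expectation_sum_P_comp[of "\<lambda>e p. \<alpha> e * X e p"] integral_mult_right_zero ..
  finally have EW: "expectation (\<lambda>\<omega>. weight_square a (P \<omega>)) =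
      (\<Sum>e\<in>?I. \<alpha> e * expectation (\<lambda>\<omega>. X e (P \<omega>)))" .
  have "(weight_square a (P \<omega>) - expectation (\<lambda>\<omega>. weight_square a (P \<omega>)))\<^sup>2 =
      (\<Sum>x\<in>?I \<times> ?I. \<alpha> (fst x) * \<alpha> (snd x) * (D (fst x) (P \<omega>) * D (snd x) (P \<omega>)))"
    if "\<omega> \<in> space M" for \<omega>
  proof -
    have centred: "weight_square a (P \<omega>) - expectation (\<lambda>\<omega>. weight_square a (P \<omega>)) = (\<Sum>e\<in>?I. \<alpha> e * D e (P \<omega>))"
      unfolding W[OF that] EW D_def right_diff_distrib sum_subtractf ..
    show ?thesis
      unfolding centred power2_eq_square sum_product sum.cartesian_product case_prod_unfold
      by (intro sum.cong refl) (simp add: mult_ac)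
  qed
  then have "variance (\<lambda>\<omega>. weight_square a (P \<omega>)) =
      expectation (\<lambda>\<omega>. \<Sum>x\<in>?I \<times> ?I. \<alpha> (fst x) * \<alpha> (snd x) * (D (fst x) (P \<omega>) * D (snd x) (P \<omega>)))"
    by (intro Bochner_Integration.integral_cong refl)
  also have "\<dots> = (\<Sum>x\<in>?I \<times> ?I. \<alpha> (fst x) * \<alpha> (snd x) *
      expectation (\<lambda>\<omega>. D (fst x) (P \<omega>) * D (snd x) (P \<omega>)))"
    unfolding expectation_sum_P_comp[of "\<lambda>x p. \<alpha> (fst x) * \<alpha> (snd x) * (D (fst x) p * D (snd x) p)"]
      integral_mult_right_zero ..
  finally show ?thesis
    by (simp add: covariance_def D_def X_def \<alpha>_def case_prod_unfold)
qed

text \<open>The hypothesis bounds the covariances only from above, while the products of the \<open>a i\<close> may have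
  either sign. The case \<open>a = 1\<close> of the expansion supplies the missing lower bound: the sum of
  all covariances is itself a variance, hence nonnegative.\<close>
lemma weight_square_variance_bound:
  assumes dom: pair_covariances_dominated and a: "\<And>i. i \<in> {1..m} \<Longrightarrow> \<bar>a i\<bar> \<le> A"
  shows "variance (\<lambda>\<omega>. weight_square a (P \<omega>)) \<le>
    2 * A ^ 4 * (\<Sum>i=1..m. \<Sum>j=1..m. \<Sum>k=1..m. \<Sum>l=1..m. quadruple_prob i j k l)"
proof -
  let ?I = "({1..m} \<times> {1..m}) \<times> ({1..m} \<times> {1..m})"
  define c where "c = (\<lambda>((i, j), (k, l)).
    covariance M (\<lambda>\<omega>. of_bool (same_part (P \<omega>) i j)) (\<lambda>\<omega>. of_bool (same_part (P \<omega>) k l)))"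
  define F where "F = (\<lambda>((i, j), (k, l)). quadruple_prob i j k l)"
  define \<alpha> where "\<alpha> = (\<lambda>((i, j), (k, l)). a i * a j * (a k * a l))"
  have "0 \<le> variance (\<lambda>\<omega>. weight_square (\<lambda>_. 1) (P \<omega>))"
    by (rule variance_positive)
  also have "\<dots> = (\<Sum>x\<in>?I. c x)"
    unfolding weight_square_variance_expansion c_def by simp
  finally have c_sum: "0 \<le> (\<Sum>x\<in>?I. c x)" .
  have \<alpha>: "\<bar>\<alpha> x\<bar> \<le> A ^ 4" if "x \<in> ?I" for x
  proof -
    obtain i j k l where x: "x = ((i, j), (k, l))" by (metis surj_pair)
    have "\<bar>\<alpha> x\<bar> = \<bar>a i\<bar> * \<bar>a j\<bar> * (\<bar>a k\<bar> * \<bar>a l\<bar>)"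
      by (simp add: \<alpha>_def x abs_mult)
    also have "\<dots> \<le> A * A * (A * A)"
      using that a[of i] a[of j] a[of k] a[of l] abs_ge_zero[of "a i"] unfolding x
      by (intro mult_mono mult_nonneg_nonneg) auto
    finally show ?thesis by (simp add: power4_eq_xxxx mult.assoc)
  qed
  have "variance (\<lambda>\<omega>. weight_square a (P \<omega>)) = (\<Sum>x\<in>?I. \<alpha> x * c x)"
    unfolding weight_square_variance_expansion c_def \<alpha>_def by (simp add: case_prod_unfold)
  also have "\<dots> \<le> (\<Sum>x\<in>?I. A ^ 4 * \<bar>c x\<bar>)"
  proof (rule sum_mono)
    fix x assume "x \<in> ?I"
    have "\<alpha> x * c x \<le> \<bar>\<alpha> x\<bar> * \<bar>c x\<bar>" by (metis abs_ge_self abs_mult)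
    also have "\<dots> \<le> A ^ 4 * \<bar>c x\<bar>" using \<alpha>[OF \<open>x \<in> ?I\<close>] by (intro mult_right_mono) auto
    finally show "\<alpha> x * c x \<le> A ^ 4 * \<bar>c x\<bar>" .
  qed
  also have "\<dots> = A ^ 4 * (\<Sum>x\<in>?I. \<bar>c x\<bar>)" by (simp add: sum_distrib_left)
  also have "\<dots> \<le> A ^ 4 * (2 * (\<Sum>x\<in>?I. F x))"
    using dom c_sum
    by (intro mult_left_mono sum_abs_le_twice_sum_bound)
      (auto simp: pair_covariances_dominated_def c_def F_def quadruple_prob_def)
  also have "(\<Sum>x\<in>?I. F x) = (\<Sum>i=1..m. \<Sum>j=1..m. \<Sum>k=1..m. \<Sum>l=1..m. quadruple_prob i j k l)"
    by (simp add: F_def sum.cartesian_product')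
  finally show ?thesis by simp
qed

section \<open>Characteristic function of the normalised linear form\<close>

lemma sum_block_weight_cubes_le:
  assumes p: "partition_on {1..m} p" and a: "\<And>i. i \<in> {1..m} \<Longrightarrow> \<bar>a i\<bar> \<le> A"
  shows "(\<Sum>B\<in>p. \<bar>\<Sum>i\<in>B. a i\<bar> ^ 3) \<le> A ^ 3 * (\<Sum>B\<in>p. real (card B) ^ 3)"
  unfolding sum_distrib_left
proof (rule sum_mono)
  fix B assume "B \<in> p"
  then have "B \<subseteq> {1..m}" using p by (auto dest: partition_onD1)
  have "\<bar>\<Sum>i\<in>B. a i\<bar> \<le> (\<Sum>i\<in>B. \<bar>a i\<bar>)" by (rule sum_abs)
  also have "\<dots> \<le> (\<Sum>i\<in>B. A)" using a \<open>B \<subseteq> {1..m}\<close> by (intro sum_mono) auto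
  finally have "\<bar>\<Sum>i\<in>B. a i\<bar> \<le> A * real (card B)" by (simp add: mult.commute)
  then have "\<bar>\<Sum>i\<in>B. a i\<bar> ^ 3 \<le> (A * real (card B)) ^ 3" by (intro power_mono) auto
  then show "\<bar>\<Sum>i\<in>B. a i\<bar> ^ 3 \<le> A ^ 3 * real (card B) ^ 3" by (simp add: power_mult_distrib)
qed

lemma weight_square_nonneg: "weight_square a p \<ge> 0"
  unfolding weight_square_def by (intro sum_nonneg) auto

text \<open>Averaging the conditional estimate over the partition.\<close>
lemma linear_form_char:
  assumes a: "\<And>i. i \<in> {1..m} \<Longrightarrow> \<bar>a i\<bar> \<le> A"
  shows "cmod (char (distr M borel (linear_form a)) t -
      expectation (\<lambda>\<omega>. exp (- (t\<^sup>2 * colour.second_moment / 2 * weight_square a (P \<omega>)))))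
    \<le> colour.gaussian_error * \<bar>t\<bar> ^ 3 * (A ^ 3 *
      (\<Sum>i=1..m. \<Sum>j=1..m. \<Sum>k=1..m. triple_prob i j k))"
proof -
  define h :: "nat set set \<Rightarrow> real"
    where "h p = exp (- (t\<^sup>2 * colour.second_moment / 2 * weight_square a p))" for p
  \<comment> \<open>On partitions of probability zero the conditional integral is replaced by its Gaussian
    approximation, so that the bound below holds for every partition.\<close>
  define g :: "nat set set \<Rightarrow> complex"
    where "g p = (if prob {\<omega>\<in>space M. P \<omega> = p} > 0
      then integral\<^sup>L (cond p) (\<lambda>\<omega>. iexp (t * linear_form a \<omega>)) else h p)" for p
  define r where "r p = colour.gaussian_error * \<bar>t\<bar> ^ 3 * (A ^ 3 * (\<Sum>B\<in>p. real (card B) ^ 3))" for p :: "nat set set"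
  have gh: "cmod (g p - h p) \<le> r p" if p: "partition_on {1..m} p" for p
  proof (cases "prob {\<omega>\<in>space M. P \<omega> = p} > 0")
    case True
    have "cmod (g p - h p) \<le> colour.gaussian_error * \<bar>t\<bar> ^ 3 * (\<Sum>B\<in>p. \<bar>\<Sum>i\<in>B. a i\<bar> ^ 3)"
      using linear_form_cond_char[OF p True, of t a] True by (simp add: g_def h_def)
    also have "\<dots> \<le> r p"
      unfolding r_def using colour.gaussian_error_nonneg
      by (intro mult_left_mono sum_block_weight_cubes_le[OF p a]) auto
    finally show ?thesis .
  next
    case False
    have "0 \<le> A ^ 3 * (\<Sum>B\<in>p. real (card B) ^ 3)"
      using sum_block_weight_cubes_le[OF p a] by (rule order_trans[rotated]) (auto intro: sum_nonneg)
    then show ?thesis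
      using False colour.gaussian_error_nonneg by (simp add: g_def r_def)
  qed
  have "char (distr M borel (linear_form a)) t = expectation (\<lambda>\<omega>. iexp (t * linear_form a \<omega>))"
    by (simp add: char_def integral_distr)
  also have "\<dots> = expectation (\<lambda>\<omega>. g (P \<omega>))"
  proof (rule total_expectation(2))
    fix p assume p: "partition_on {1..m} p" and pos: "prob {\<omega>\<in>space M. P \<omega> = p} > 0"
    interpret Q: prob_space "cond p" by (rule prob_space_cond[OF p pos])
    show "integrable (cond p) (\<lambda>\<omega>. iexp (t * linear_form a \<omega>)) \<and>
        integral\<^sup>L (cond p) (\<lambda>\<omega>. iexp (t * linear_form a \<omega>)) = g p"
      using pos by (auto simp: g_def intro!: Q.integrable_const_bound[where B=1])
  qed simp
  finally have "char (distr M borel (linear_form a)) t - expectation (\<lambda>\<omega>. h (P \<omega>)) =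
      expectation (\<lambda>\<omega>. g (P \<omega>) - h (P \<omega>))"
    using integrable_P_comp[of g] integrable_P_comp[of h] by simp
  then have "cmod (char (distr M borel (linear_form a)) t - expectation (\<lambda>\<omega>. h (P \<omega>)))
      \<le> expectation (\<lambda>\<omega>. cmod (g (P \<omega>) - h (P \<omega>)))"
    by simp
  also have "\<dots> \<le> expectation (\<lambda>\<omega>. r (P \<omega>))"
    using integrable_P_comp[of "\<lambda>p. cmod (g p - h p)"] integrable_P_comp[of r]
    by (intro integral_mono gh P_partition)
  also have "\<dots> = colour.gaussian_error * \<bar>t\<bar> ^ 3 * (A ^ 3 *
      (\<Sum>i=1..m. \<Sum>j=1..m. \<Sum>k=1..m. triple_prob i j k))"
    unfolding r_def integral_mult_right_zero expectation_block_cubes ..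
  finally show ?thesis unfolding h_def .
qed

text \<open>The Gaussian with random variance \<open>\<sigma>\<^sup>2 W\<close> is replaced by one with variance \<open>\<sigma>\<^sup>2 \<^bold>E W\<close>.
  As \<open>exp (- x)\<close> is a contraction on the nonnegative numbers, this costs at most a multiple of the
  relative mean deviation of \<open>W\<close>, which is at most its relative standard deviation.\<close>
lemma normalised_linear_form_char:
  fixes a :: "nat \<Rightarrow> real"
  defines "S \<equiv> \<Sum>i=1..m. \<Sum>j=1..m. a i * a j * pair_prob i j"
  assumes a: "\<And>i. i \<in> {1..m} \<Longrightarrow> \<bar>a i\<bar> \<le> A" and dom: pair_covariances_dominated
    and S: "S > 0" and pos: "colour.second_moment > 0"
  shows "cmod (char (distr M borel (\<lambda>\<omega>. linear_form a \<omega> / sqrt (colour.second_moment * S))) t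
      - exp (- (t\<^sup>2) / 2))
    \<le> colour.gaussian_error * (\<bar>t\<bar> / sqrt (colour.second_moment * S)) ^ 3 *
        (A ^ 3 * (\<Sum>i=1..m. \<Sum>j=1..m. \<Sum>k=1..m. triple_prob i j k))
      + t\<^sup>2 / 2 * (sqrt (2 * A ^ 4 *
        (\<Sum>i=1..m. \<Sum>j=1..m. \<Sum>k=1..m. \<Sum>l=1..m. quadruple_prob i j k l)) / S)"
proof -
  let ?W = "\<lambda>\<omega>. weight_square a (P \<omega>)"
  let ?s = "sqrt (colour.second_moment * S)"
  define u where "u = t / ?s"
  have u2: "u\<^sup>2 * colour.second_moment = t\<^sup>2 / S"
    using S pos by (simp add: u_def power_divide)
  have EW: "expectation ?W = S"
    unfolding S_def by (rule expectation_weight_square)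
  define f where "f \<omega> = exp (- (u\<^sup>2 * colour.second_moment / 2 * ?W \<omega>))" for \<omega>
  have intf: "integrable M f"
    unfolding f_def by (rule integrable_P_comp[of "\<lambda>p. exp (- (u\<^sup>2 * colour.second_moment / 2 * weight_square a p))"])
  have pointwise: "\<bar>f \<omega> - exp (- (t\<^sup>2) / 2)\<bar> \<le> t\<^sup>2 / 2 / S * \<bar>?W \<omega> - S\<bar>" for \<omega>
  proof -
    have "\<bar>f \<omega> - exp (- (t\<^sup>2 / 2))\<bar> \<le> \<bar>u\<^sup>2 * colour.second_moment / 2 * ?W \<omega> - t\<^sup>2 / 2\<bar>"
      unfolding f_def using pos weight_square_nonneg by (intro abs_exp_minus_diff_le) auto
    also have "u\<^sup>2 * colour.second_moment / 2 * ?W \<omega> - t\<^sup>2 / 2 = t\<^sup>2 / 2 / S * (?W \<omega> - S)"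
      unfolding u2 using S by (simp add: field_simps)
    finally show ?thesis using S by (simp add: abs_mult)
  qed
  have "\<bar>expectation f - exp (- (t\<^sup>2) / 2)\<bar> = \<bar>expectation (\<lambda>\<omega>. f \<omega> - exp (- (t\<^sup>2) / 2))\<bar>"
    using intf by (simp add: prob_space)
  also have "\<dots> \<le> expectation (\<lambda>\<omega>. \<bar>f \<omega> - exp (- (t\<^sup>2) / 2)\<bar>)"
    by (rule integral_abs_bound)
  also have "\<dots> \<le> expectation (\<lambda>\<omega>. t\<^sup>2 / 2 / S * \<bar>?W \<omega> - S\<bar>)"
    using intf by (intro integral_mono pointwise integrable_P_comp) auto
  also have "\<dots> = t\<^sup>2 / 2 / S * expectation (\<lambda>\<omega>. \<bar>?W \<omega> - S\<bar>)"
    by (rule integral_mult_right_zero)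
  also have "\<dots> \<le> t\<^sup>2 / 2 / S * sqrt (variance ?W)"
    unfolding EW using S
    by (intro mult_left_mono expectation_abs_le_sqrt integrable_P_comp) auto
  also have "\<dots> \<le> t\<^sup>2 / 2 / S * sqrt (2 * A ^ 4 *
      (\<Sum>i=1..m. \<Sum>j=1..m. \<Sum>k=1..m. \<Sum>l=1..m. quadruple_prob i j k l))"
    using S by (intro mult_left_mono real_sqrt_le_mono weight_square_variance_bound dom a) auto
  finally have 1: "cmod (complex_of_real (expectation f) - exp (- (t\<^sup>2) / 2)) \<le> \<dots>"
    unfolding of_real_diff[symmetric] norm_of_real .
  have "char (distr M borel (\<lambda>\<omega>. linear_form a \<omega> / ?s)) t = char (distr M borel (linear_form a)) u"
    by (simp add: char_def integral_distr u_def)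
  moreover have "\<bar>u\<bar> = \<bar>t\<bar> / ?s" using S pos by (simp add: u_def)
  ultimately have 2: "cmod (char (distr M borel (\<lambda>\<omega>. linear_form a \<omega> / ?s)) t - expectation f)
    \<le> colour.gaussian_error * (\<bar>t\<bar> / ?s) ^ 3 *
        (A ^ 3 * (\<Sum>i=1..m. \<Sum>j=1..m. \<Sum>k=1..m. triple_prob i j k))"
    using linear_form_char[of a A u] a unfolding f_def by simp
  show ?thesis
    using norm_triangle_le[OF add_mono[OF 2 1]] by simp
qed

section \<open>Random indices\<close>

text \<open>The index quadruple takes each value with probability \<open>m\<^sup>-\<^sup>4\<close>, independently of the partition.
  Events that involve fewer indices are covered too: the superfluous sums give factors \<open>m\<close>.\<close>
lemma prob_independent_indices:
  assumes indep: "independent_uniform_indices M m P (colour_at P C) I J K L" and m: "m \<ge> 1"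
  shows "prob {\<omega>\<in>space M. R (P \<omega>) (I \<omega>) (J \<omega>) (K \<omega>) (L \<omega>)} =
    (\<Sum>i=1..m. \<Sum>j=1..m. \<Sum>k=1..m. \<Sum>l=1..m. prob {\<omega>\<in>space M. R (P \<omega>) i j k l}) / real m ^ 4"
proof -
  define X where "X n = [I, J, K, L] ! n" for n
  define G where "G = {1..m} \<times> {1..m} \<times> {1..m} \<times> {1..m}"
  have X_in: "X n \<in> {I, J, K, L}" if "n < 4" for n
    using that by (auto simp: X_def numeral_eq_Suc less_Suc_eq)
  have X_meas[measurable]: "X n \<in> M \<rightarrow>\<^sub>M count_space UNIV"
    and X_distr: "distr M (count_space UNIV) (X n) = measure_pmf (pmf_of_set {1..m})" if "n < 4" for n
    using indep X_in[OF that] unfolding independent_uniform_indices_def by auto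
  have IJKL[measurable]: "I \<in> M \<rightarrow>\<^sub>M count_space UNIV" "J \<in> M \<rightarrow>\<^sub>M count_space UNIV"
    "K \<in> M \<rightarrow>\<^sub>M count_space UNIV" "L \<in> M \<rightarrow>\<^sub>M count_space UNIV"
    using indep unfolding independent_uniform_indices_def by auto
  have X_prob: "prob (X n -` {i} \<inter> space M) = 1 / real m" if "n < 4" "i \<in> {1..m}" for n i
  proof -
    have "prob (X n -` {i} \<inter> space M) = measure (distr M (count_space UNIV) (X n)) {i}"
      using that by (subst measure_distr) auto
    also have "\<dots> = 1 / real m"
      unfolding X_distr[OF that(1)] using that(2) by (simp add: measure_pmf_of_set)
    finally show ?thesis .
  qed
  have X_AE: "AE \<omega> in M. X n \<omega> \<in> {1..m}" if "n < 4" for n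
  proof -
    have "AE x in distr M (count_space UNIV) (X n). x \<in> {1..m}"
      unfolding X_distr[OF that] using m by (simp add: AE_measure_pmf_iff)
    then show ?thesis
      by (rule AE_distrD[OF X_meas[OF that]])
  qed
  define T where "T \<omega> = (I \<omega>, J \<omega>, K \<omega>, L \<omega>)" for \<omega>
  define E where "E x = {\<omega>\<in>space M. case x of (i, j, k, l) \<Rightarrow> R (P \<omega>) i j k l}" for x
  have T_AE: "AE \<omega> in M. T \<omega> \<in> G"
  proof -
    have "AE \<omega> in M. \<forall>n\<in>{0..<4}. X n \<omega> \<in> {1..m}"
      using X_AE by (intro AE_finite_allI) auto
    then show ?thesis
      by (rule AE_mp) (auto simp: T_def G_def X_def numeral_eq_Suc atLeast0_lessThan_Suc)
  qed
  have T_prob: "prob (T -` {x} \<inter> space M) = 1 / real m ^ 4" if x: "x \<in> G" for x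
  proof -
    obtain i j k l where x_eq: "x = (i, j, k, l)" by (metis surj_pair)
    define y where "y n = [i, j, k, l] ! n" for n
    have "indep_vars (\<lambda>_. count_space UNIV) X {0..<4}"
      using indep unfolding independent_uniform_indices_def X_def by auto
    then have "prob (\<Inter>n\<in>{0..<4}. X n -` {y n} \<inter> space M) = (\<Prod>n\<in>{0..<4}. prob (X n -` {y n} \<inter> space M))"
      by (rule indep_varsD) auto
    also have "\<dots> = (\<Prod>n\<in>{0..<4::nat}. 1 / real m)"
      using x by (intro prod.cong refl X_prob)
        (auto simp: y_def x_eq G_def numeral_eq_Suc less_Suc_eq nth_Cons split: nat.splits)
    also have "(\<Inter>n\<in>{0..<4}. X n -` {y n} \<inter> space M) = T -` {x} \<inter> space M"
      by (auto simp: X_def y_def T_def x_eq numeral_eq_Suc atLeast0_lessThan_Suc)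
    finally show ?thesis by (simp add: power_one_over)
  qed
  have T_E: "prob ((T -` {x} \<inter> space M) \<inter> E x) = prob (E x) / real m ^ 4" if x: "x \<in> G" for x
  proof -
    obtain i j k l where x_eq: "x = (i, j, k, l)" by (metis surj_pair)
    let ?Y = "\<lambda>\<omega>. (P \<omega>, restrict (\<lambda>i. colour_at P C i \<omega>) {1..m})"
    let ?B = "{p\<in>partitions. R p i j k l} \<times> space (PiM {1..m} (\<lambda>_. borel :: real measure))"
    have 1: "T -` {x} \<inter> space M \<in> sets (vimage_algebra (space M) (\<lambda>\<omega>. (I \<omega>, J \<omega>, K \<omega>, L \<omega>)) (count_space UNIV))"
      using in_vimage_algebra[of "{x}" "count_space UNIV" "\<lambda>\<omega>. (I \<omega>, J \<omega>, K \<omega>, L \<omega>)" "space M"]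
      by (simp add: T_def[abs_def])
    have "?B \<in> sets (partition_space m \<Otimes>\<^sub>M PiM {1..m} (\<lambda>_. borel))"
      by (intro pair_measureI sets.top) (auto simp: partition_space_def)
    then have "?Y -` ?B \<inter> space M \<in>
        sets (vimage_algebra (space M) ?Y (partition_space m \<Otimes>\<^sub>M PiM {1..m} (\<lambda>_. borel)))"
      by (rule in_vimage_algebra)
    moreover have "?Y -` ?B \<inter> space M = E x"
      using P_partition by (auto simp: E_def x_eq space_PiM)
    ultimately have 2: "E x \<in> sets (vimage_algebra (space M) ?Y (partition_space m \<Otimes>\<^sub>M PiM {1..m} (\<lambda>_. borel)))"
      by simp
    have "prob ((T -` {x} \<inter> space M) \<inter> E x) = prob (T -` {x} \<inter> space M) * prob (E x)"
      using indep 1 2 unfolding independent_uniform_indices_def by (blast intro: indep_setD)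
    then show ?thesis using T_prob[OF x] by simp
  qed
  have TE_events: "(T -` {x} \<inter> space M) \<inter> E x \<in> events" for x
  proof -
    obtain i j k l where x_eq: "x = (i, j, k, l)" by (metis surj_pair)
    have "T -` {x} \<inter> space M = (I -` {i} \<inter> space M) \<inter> (J -` {j} \<inter> space M) \<inter>
        (K -` {k} \<inter> space M) \<inter> (L -` {l} \<inter> space M)"
      by (auto simp: T_def x_eq)
    also have "\<dots> \<in> events"
      by (intro sets.Int measurable_sets[OF IJKL(1)] measurable_sets[OF IJKL(2)]
          measurable_sets[OF IJKL(3)] measurable_sets[OF IJKL(4)]) auto
    finally show ?thesis
      by (auto simp: E_def x_eq)
  qed
  have fin: "finite G" by (simp add: G_def)
  have "{\<omega>\<in>space M. R (P \<omega>) (I \<omega>) (J \<omega>) (K \<omega>) (L \<omega>)} \<in> events"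
  proof -
    have "{\<omega>\<in>space M. R (P \<omega>) (I \<omega>) (J \<omega>) (K \<omega>) (L \<omega>)} = (\<Union>x. (T -` {x} \<inter> space M) \<inter> E x)"
      by (auto simp: T_def E_def)
    then show ?thesis using TE_events by auto
  qed
  then have "prob {\<omega>\<in>space M. R (P \<omega>) (I \<omega>) (J \<omega>) (K \<omega>) (L \<omega>)} =
      prob (\<Union>x\<in>G. (T -` {x} \<inter> space M) \<inter> E x)"
    using T_AE TE_events fin
    by (intro finite_measure_eq_AE) (auto simp: T_def E_def elim!: eventually_mono)
  also have "\<dots> = (\<Sum>x\<in>G. prob ((T -` {x} \<inter> space M) \<inter> E x))"
    using TE_events fin by (intro finite_measure_finite_Union) (auto simp: disjoint_family_on_def)
  also have "\<dots> = (\<Sum>x\<in>G. prob (E x) / real m ^ 4)"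
    by (intro sum.cong refl T_E)
  also have "\<dots> = (\<Sum>i=1..m. \<Sum>j=1..m. \<Sum>k=1..m. \<Sum>l=1..m. prob {\<omega>\<in>space M. R (P \<omega>) i j k l}) / real m ^ 4"
    by (simp add: G_def E_def sum.cartesian_product case_prod_unfold sum_divide_distrib)
  finally show ?thesis .
qed

lemma pair_prob_diagonal:
  assumes "i \<in> {1..m}"
  shows "pair_prob i i = 1"
proof -
  have "{\<omega>\<in>space M. same_part (P \<omega>) i i} = space M"
    using assms P_partition same_part_iff part_of_mem by blast
  then show ?thesis by (simp add: pair_prob_def prob_space)
qed

lemma sum_pair_prob_ge: "(\<Sum>i=1..m. \<Sum>j=1..m. pair_prob i j) \<ge> real m"
proof -
  have "real m = (\<Sum>i=1..m. pair_prob i i)" using pair_prob_diagonal by simp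
  also have "\<dots> \<le> (\<Sum>i=1..m. \<Sum>j=1..m. pair_prob i j)"
    by (intro sum_mono member_le_sum) (auto simp: pair_prob_def)
  finally show ?thesis .
qed

text \<open>The error in terms of the probabilities \<open>q\<close>, \<open>r\<close>, \<open>s\<close> that two, three, four random indices
  are equivalent. All powers of \<open>m\<close> cancel, since sums over pairs, triples and quadruples scale
  like \<open>m\<^sup>2\<close>, \<open>m\<^sup>3\<close>, \<open>m\<^sup>4\<close>, and the first enters with the exponents \<open>3 / 2\<close> and \<open>2\<close>, respectively.\<close>
lemma normalised_linear_form_char_indices:
  fixes I J K L :: "'w \<Rightarrow> nat" and a :: "nat \<Rightarrow> real"
  defines "S \<equiv> \<Sum>i=1..m. \<Sum>j=1..m. a i * a j * pair_prob i j"
    and "q \<equiv> prob {\<omega>\<in>space M. same_part (P \<omega>) (I \<omega>) (J \<omega>)}"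
    and "r \<equiv> prob {\<omega>\<in>space M. same_part (P \<omega>) (I \<omega>) (J \<omega>) \<and> same_part (P \<omega>) (J \<omega>) (K \<omega>)}"
    and "s \<equiv> prob {\<omega>\<in>space M. same_part (P \<omega>) (I \<omega>) (J \<omega>) \<and> same_part (P \<omega>) (J \<omega>) (K \<omega>) \<and>
      same_part (P \<omega>) (K \<omega>) (L \<omega>)}"
  assumes m: "m \<ge> 1" and indep: "independent_uniform_indices M m P (colour_at P C) I J K L"
    and dom: pair_covariances_dominated and pos: "colour.second_moment > 0"
    and a: "\<And>i. i \<in> {1..m} \<Longrightarrow> \<bar>a i\<bar> \<le> A" and c: "c > 0"
    and S_ge: "S \<ge> c * (\<Sum>i=1..m. \<Sum>j=1..m. pair_prob i j)"
  shows "S > 0"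
    and "cmod (char (distr M borel (\<lambda>\<omega>. linear_form a \<omega> / sqrt (colour.second_moment * S))) t
        - exp (- (t\<^sup>2) / 2))
      \<le> colour.gaussian_error * A ^ 3 * (\<bar>t\<bar> / sqrt (colour.second_moment * c)) ^ 3 * (r / q powr (3 / 2))
        + t\<^sup>2 / 2 * (sqrt 2 * A\<^sup>2 / c) * sqrt (s / q\<^sup>2)"
proof -
  define T where "T = (\<Sum>i=1..m. \<Sum>j=1..m. pair_prob i j)"
  define G where "G = (\<Sum>i=1..m. \<Sum>j=1..m. \<Sum>k=1..m. triple_prob i j k)"
  define F where "F = (\<Sum>i=1..m. \<Sum>j=1..m. \<Sum>k=1..m. \<Sum>l=1..m. quadruple_prob i j k l)"
  let ?\<sigma>2 = "colour.second_moment"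
  have "1 \<in> {1..m}" using m by simp
  then have A: "A \<ge> 0" using a[of 1] abs_ge_zero[of "a 1"] by linarith
  have T_ge: "T \<ge> m" unfolding T_def by (rule sum_pair_prob_ge)
  have T: "T > 0" using T_ge m by simp
  have cT: "0 < c * T" "c * T \<le> S" using c T S_ge by (auto simp: T_def)
  then show S: "S > 0" by linarith
  have qT: "T = real m ^ 2 * q"
    using prob_independent_indices[OF indep m, of "\<lambda>p i j k l. same_part p i j"] m
    by (simp add: q_def T_def pair_prob_def sum_distrib_left[symmetric] field_simps power4_eq_xxxx power2_eq_square)
  have rG: "G = real m ^ 3 * r"
    using prob_independent_indices[OF indep m, of "\<lambda>p i j k l. same_part p i j \<and> same_part p j k"] m
    by (simp add: r_def G_def triple_prob_def sum_distrib_left[symmetric] field_simps power4_eq_xxxx power3_eq_cube)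
  have sF: "F = real m ^ 4 * s"
    using prob_independent_indices[OF indep m, of "\<lambda>p i j k l. same_part p i j \<and> same_part p j k \<and> same_part p k l"] m
    by (simp add: s_def F_def quadruple_prob_def field_simps)
  have q: "q > 0" using T qT m by (simp add: zero_less_mult_iff)
  have r: "r \<ge> 0" and s: "s \<ge> 0" by (simp_all add: r_def s_def)
  have q_powr: "q powr (3 / 2) = sqrt q ^ 3"
    using q by (simp add: powr_half_sqrt[symmetric] powr_power)
  have "(\<bar>t\<bar> / sqrt (?\<sigma>2 * S)) ^ 3 * (A ^ 3 * G) \<le> (\<bar>t\<bar> / sqrt (?\<sigma>2 * (c * T))) ^ 3 * (A ^ 3 * G)"
    using cT pos A r by (intro mult_right_mono power_mono divide_left_mono real_sqrt_le_mono mult_left_mono)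
      (auto simp: rG)
  also have "sqrt (?\<sigma>2 * (c * T)) = sqrt (?\<sigma>2 * c) * (real m * sqrt q)"
    using qT by (simp add: real_sqrt_mult)
  also have "(\<bar>t\<bar> / (sqrt (?\<sigma>2 * c) * (real m * sqrt q))) ^ 3 * (A ^ 3 * G) =
      A ^ 3 * (\<bar>t\<bar> / sqrt (?\<sigma>2 * c)) ^ 3 * (r / q powr (3 / 2))"
    using m q unfolding rG q_powr by (simp add: power_divide power_mult_distrib)
  finally have "colour.gaussian_error * ((\<bar>t\<bar> / sqrt (?\<sigma>2 * S)) ^ 3 * (A ^ 3 * G)) \<le>
      colour.gaussian_error * (A ^ 3 * (\<bar>t\<bar> / sqrt (?\<sigma>2 * c)) ^ 3 * (r / q powr (3 / 2)))"
    by (rule mult_left_mono[OF _ colour.gaussian_error_nonneg])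
  then have 1: "colour.gaussian_error * (\<bar>t\<bar> / sqrt (?\<sigma>2 * S)) ^ 3 * (A ^ 3 * G) \<le>
      colour.gaussian_error * A ^ 3 * (\<bar>t\<bar> / sqrt (?\<sigma>2 * c)) ^ 3 * (r / q powr (3 / 2))"
    by (simp only: mult.assoc)
  define x where "x = A\<^sup>2 * (real m)\<^sup>2"
  have "x \<ge> 0" by (simp add: x_def)
  have "2 * A ^ 4 * F = 2 * x\<^sup>2 * s"
    unfolding sF x_def by (simp add: power2_eq_square power4_eq_xxxx)
  then have "sqrt (2 * A ^ 4 * F) = sqrt (2 * x\<^sup>2 * s)" by (simp only:)
  also have "\<dots> = sqrt 2 * x * sqrt s"
    using \<open>x \<ge> 0\<close> by (simp add: real_sqrt_mult)
  finally have "sqrt (2 * A ^ 4 * F) / S = sqrt 2 * x * sqrt s / S" by (simp only:)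
  also have "\<dots> \<le> sqrt 2 * x * sqrt s / (c * T)"
    using cT S \<open>x \<ge> 0\<close> s by (intro divide_left_mono mult_nonneg_nonneg mult_pos_pos[OF S cT(1)]) auto
  also have "\<dots> = sqrt 2 * A\<^sup>2 / c * sqrt (s / q\<^sup>2)"
    unfolding qT x_def using m q by (simp add: real_sqrt_divide)
  finally have "t\<^sup>2 / 2 * (sqrt (2 * A ^ 4 * F) / S) \<le> t\<^sup>2 / 2 * (sqrt 2 * A\<^sup>2 / c * sqrt (s / q\<^sup>2))"
    by (rule mult_left_mono) simp
  then have 2: "t\<^sup>2 / 2 * (sqrt (2 * A ^ 4 * F) / S) \<le> t\<^sup>2 / 2 * (sqrt 2 * A\<^sup>2 / c) * sqrt (s / q\<^sup>2)"
    by (simp only: mult.assoc)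
  show "cmod (char (distr M borel (\<lambda>\<omega>. linear_form a \<omega> / sqrt (?\<sigma>2 * S))) t - exp (- (t\<^sup>2) / 2))
      \<le> colour.gaussian_error * A ^ 3 * (\<bar>t\<bar> / sqrt (?\<sigma>2 * c)) ^ 3 * (r / q powr (3 / 2))
        + t\<^sup>2 / 2 * (sqrt 2 * A\<^sup>2 / c) * sqrt (s / q\<^sup>2)"
    using order_trans[OF normalised_linear_form_char[of a A t, OF a dom S[unfolded S_def] pos,
        folded G_def F_def S_def] add_mono[OF 1 2]] .
qed

lemma sum_colour_sums:
  assumes "\<And>g. g \<in> A \<Longrightarrow> n g \<le> m"
  shows "(\<Sum>g\<in>A. \<beta> g * colour_sum P C (n g) \<omega>) =
    linear_form (\<lambda>i. \<Sum>g\<in>A. \<beta> g * of_bool (i \<le> n g)) \<omega>"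
proof -
  have "colour_sum P C (n g) \<omega> = (\<Sum>i=1..m. of_bool (i \<le> n g) * colour_at P C i \<omega>)" if "g \<in> A" for g
    unfolding colour_sum_def using assms[OF that]
    by (intro sum.mono_neutral_cong_left) auto
  then have "(\<Sum>g\<in>A. \<beta> g * colour_sum P C (n g) \<omega>) =
      (\<Sum>g\<in>A. \<Sum>i=1..m. \<beta> g * of_bool (i \<le> n g) * colour_at P C i \<omega>)"
    unfolding mult.assoc sum_distrib_left[symmetric] by (intro sum.cong refl) simp
  also have "\<dots> = linear_form (\<lambda>i. \<Sum>g\<in>A. \<beta> g * of_bool (i \<le> n g)) \<omega>"
    unfolding linear_form_def sum_distrib_right by (rule sum.swap)
  finally show ?thesis .
qed

end

section \<open>Asymptotic normality\<close>

text \<open>Summation by parts: the partial sum up to \<open>\<lfloor>\<rho>\<^sub>h m\<rfloor>\<close> involves the index \<open>i\<close> exactly if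
  \<open>i\<close> lies in one of the first \<open>h\<close> ranges, so that \<open>i\<close> receives the tail sum of the \<open>\<beta> h\<close>
  that starts at its own range.\<close>
lemma step_coeff_tail_sums:
  fixes \<rho> \<beta> :: "nat \<Rightarrow> real"
  assumes \<rho>: "\<rho> 0 = 0" "\<rho> d = 1" "mono_on {0..d} \<rho>" and i: "i \<in> {1..m}"
  shows "step_coeff d \<rho> (\<lambda>g. \<Sum>h=g..d. \<beta> h) m i =
    (\<Sum>h=1..d. \<beta> h * of_bool (i \<le> nat \<lfloor>\<rho> h * real m\<rfloor>))"
proof -
  define n where "n g = nat \<lfloor>\<rho> g * real m\<rfloor>" for g
  have n_mono: "n g \<le> n h" if "g \<le> h" "h \<le> d" for g h
  proof -
    have "\<rho> g \<le> \<rho> h" by (rule monotone_onD[OF \<rho>(3)]) (use that in auto)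
    then have "\<rho> g * real m \<le> \<rho> h * real m" by (rule mult_right_mono) simp
    then show ?thesis unfolding n_def by (intro nat_mono floor_mono)
  qed
  have n: "n 0 = 0" "n d = m" using \<rho> by (simp_all add: n_def)
  define g where "g = (LEAST g. i \<le> n g)"
  have ig: "i \<le> n g" unfolding g_def by (rule LeastI[of _ d]) (use i n in simp)
  have gd: "g \<le> d" unfolding g_def by (rule Least_le) (use i n in simp)
  have g1: "g \<noteq> 0"
  proof
    assume "g = 0"
    then show False using ig n i by simp
  qed
  have below: "n h < i" if "h < g" for h
    using not_less_Least[of h "\<lambda>g. i \<le> n g"] that by (simp add: g_def not_le)
  have le_iff: "i \<le> n h \<longleftrightarrow> g \<le> h" if "h \<le> d" for h
  proof (cases "g \<le> h")
    case True
    then show ?thesis using order_trans[OF ig n_mono[OF True that]] by simp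
  next
    case False
    then show ?thesis using below[of h] by simp
  qed
  have "(THE g. g \<in> {1..d} \<and> n (g - 1) < i \<and> i \<le> n g) = g"
  proof (rule the_equality)
    show "g \<in> {1..d} \<and> n (g - 1) < i \<and> i \<le> n g" using ig gd g1 below by simp
    fix h assume h: "h \<in> {1..d} \<and> n (h - 1) < i \<and> i \<le> n h"
    then have "h - 1 \<le> d" by auto
    then have "g \<le> h" "\<not> g \<le> h - 1" using h le_iff[of h] le_iff[of "h - 1"] by (auto simp: not_le)
    then show "h = g" using h by auto
  qed
  then have "step_coeff d \<rho> (\<lambda>g. \<Sum>h=g..d. \<beta> h) m i = (\<Sum>h=g..d. \<beta> h)"
    by (simp add: step_coeff_def n_def)
  also have "\<dots> = (\<Sum>h=1..d. \<beta> h * of_bool (i \<le> n h))"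
    using g1 le_iff by (intro sum.mono_neutral_cong_left) auto
  finally show ?thesis unfolding n_def .
qed

text \<open>The map from \<open>\<beta>\<close> to its tail sums is injective, which makes the lower bound on the variance
  available for every nonzero combination.\<close>
lemma tail_sums_nonzero:
  fixes \<beta> :: "nat \<Rightarrow> real"
  assumes "\<exists>g\<in>{1..d}. \<beta> g \<noteq> 0"
  shows "\<exists>g\<in>{1..d}. (\<Sum>h=g..d. \<beta> h) \<noteq> 0"
proof (rule ccontr)
  assume *: "\<not> ?thesis"
  have "\<beta> g = 0" if g: "g \<in> {1..d}" for g
  proof -
    have "(\<Sum>h=g..d. \<beta> h) = \<beta> g + (\<Sum>h=Suc g..d. \<beta> h)"
      using g by (simp add: sum.atLeast_Suc_atMost)
    moreover have "(\<Sum>h=Suc g..d. \<beta> h) = 0"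
      using * g by (cases "Suc g \<le> d") auto
    ultimately show ?thesis using * g by auto
  qed
  then show False using assms by auto
qed

theorem theorem3p1:
  fixes M :: "nat \<Rightarrow> 'w measure" and N :: "'y measure" and Y :: "'y \<Rightarrow> real"
    and P :: "nat \<Rightarrow> 'w \<Rightarrow> nat set set" and C :: "nat \<Rightarrow> nat set \<Rightarrow> 'w \<Rightarrow> real"
    and I J K L :: "nat \<Rightarrow> 'w \<Rightarrow> nat"
    and d :: nat and \<rho> :: "nat \<Rightarrow> real"
  assumes "prob_space N" and "Y \<in> borel_measurable N"
    and "integrable N (\<lambda>x. Y x ^ 4)"
    and "prob_space.expectation N Y = 0"
    and "prob_space.expectation N (\<lambda>x. Y x ^ 4) > 0"
    and "\<And>m. m \<ge> 1 \<Longrightarrow> prob_space (M m)"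
    and "\<And>m. m \<ge> 1 \<Longrightarrow> iid_coloured_partition (M m) m (P m) (C m) N Y"
    and "d \<ge> 1" and "\<rho> 0 = 0" and "\<rho> d = 1" and "strict_mono_on {0..d} \<rho>"
    and "\<And>m. m \<ge> 1 \<Longrightarrow> independent_uniform_indices (M m) m (P m) (colour_at (P m) (C m))
           (I m) (J m) (K m) (L m)"
    and i: "(\<lambda>m. measure (M m) {\<omega> \<in> space (M m).
                same_part (P m \<omega>) (I m \<omega>) (J m \<omega>) \<and> same_part (P m \<omega>) (J m \<omega>) (K m \<omega>)})
            \<in> o(\<lambda>m. measure (M m) {\<omega> \<in> space (M m).
                same_part (P m \<omega>) (I m \<omega>) (J m \<omega>)} powr (3 / 2))"
    and ii: "(\<lambda>m. measure (M m) {\<omega> \<in> space (M m).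
                same_part (P m \<omega>) (I m \<omega>) (J m \<omega>) \<and> same_part (P m \<omega>) (J m \<omega>) (K m \<omega>) \<and>
                same_part (P m \<omega>) (K m \<omega>) (L m \<omega>)})
            \<in> o(\<lambda>m. (measure (M m) {\<omega> \<in> space (M m).
                same_part (P m \<omega>) (I m \<omega>) (J m \<omega>)})\<^sup>2)"
    and iii: "\<And>m i j k l. m \<ge> 1 \<Longrightarrow> {i, j, k, l} \<subseteq> {1..m} \<Longrightarrow>
            covariance (M m) (\<lambda>\<omega>. of_bool (same_part (P m \<omega>) i j))
                             (\<lambda>\<omega>. of_bool (same_part (P m \<omega>) k l))
            \<le> measure (M m) {\<omega> \<in> space (M m). same_part (P m \<omega>) i j \<and>
                same_part (P m \<omega>) j k \<and> same_part (P m \<omega>) k l}"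
    and iv: "\<And>\<alpha> :: nat \<Rightarrow> real. \<exists>g\<in>{1..d}. \<alpha> g \<noteq> 0 \<Longrightarrow>
            \<exists>c>0. \<forall>\<^sub>F m in sequentially.
              (\<Sum>i=1..m. \<Sum>j=1..m. step_coeff d \<rho> \<alpha> m i * step_coeff d \<rho> \<alpha> m j *
                 measure (M m) {\<omega> \<in> space (M m). same_part (P m \<omega>) i j})
              \<ge> c * (\<Sum>i=1..m. \<Sum>j=1..m.
                 measure (M m) {\<omega> \<in> space (M m). same_part (P m \<omega>) i j})"
  shows "asymptotically_Gaussian d M (\<lambda>m g. colour_sum (P m) (C m) (nat \<lfloor>\<rho> g * real m\<rfloor>))"
proof -
  interpret colour: centred_colour N Y
    using assms(1-4) by (simp add: centred_colour_def centred_colour_axioms_def)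
  have part: "coloured_partition (M m) N Y m (P m) (C m)" if "m \<ge> 1" for m
    using assms(6,7)[OF that] colour.centred_colour_axioms
    by (simp add: coloured_partition_def coloured_partition_axioms_def)
  have pos: "colour.second_moment > 0" by (rule colour.second_moment_pos) fact
  have mono: "mono_on {0..d} \<rho>" using assms(11) by (rule strict_mono_on_imp_mono_on)
  define n where "n m g = nat \<lfloor>\<rho> g * real m\<rfloor>" for m g
  have n_le: "n m g \<le> m" if "g \<in> {1..d}" for m g
  proof -
    have "\<rho> g \<le> 1" using monotone_onD[OF mono, of g d] that \<open>\<rho> d = 1\<close> by auto
    then have "\<rho> g * real m \<le> 1 * real m" by (rule mult_right_mono) simp
    then show ?thesis unfolding n_def by linarith
  qed
  show ?thesis
    unfolding asymptotically_Gaussian_def n_def[symmetric]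
  proof (intro conjI allI impI ballI)
    fix m :: nat and g assume m: "1 \<le> m" and g: "g \<in> {1..d}"
    interpret cp: coloured_partition "M m" N Y m "P m" "C m" by (rule part[OF m])
    have "colour_sum (P m) (C m) (n m g) = cp.linear_form (\<lambda>i. of_bool (i \<le> n m g))"
      using cp.sum_colour_sums[of "{g}" "n m" "\<lambda>_. 1"] n_le[OF g] by (simp add: fun_eq_iff del: sum_of_bool_eq)
    then show "colour_sum (P m) (C m) (n m g) \<in> borel_measurable (M m)"
      and "integrable (M m) (\<lambda>\<omega>. (colour_sum (P m) (C m) (n m g) \<omega>)\<^sup>2)"
      and "cp.expectation (colour_sum (P m) (C m) (n m g)) = 0"
      using cp.linear_form_meas cp.linear_form_mean cp.linear_form_second_moment by simp_all
  next
    fix \<beta> :: "nat \<Rightarrow> real" assume \<beta>: "\<exists>g\<in>{1..d}. \<beta> g \<noteq> 0"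
    define V where "V m \<omega> = (\<Sum>g=1..d. \<beta> g * colour_sum (P m) (C m) (n m g) \<omega>)" for m \<omega>
    define a where "a m i = (\<Sum>g=1..d. \<beta> g * of_bool (i \<le> n m g))" for m i
    define A where "A = (\<Sum>g=1..d. \<bar>\<beta> g\<bar>)"
    define p where "p m i j = measure (M m) {\<omega> \<in> space (M m). same_part (P m \<omega>) i j}" for m i j
    define S where "S m = (\<Sum>i=1..m. \<Sum>j=1..m. a m i * a m j * p m i j)" for m
    define q where "q m = measure (M m) {\<omega> \<in> space (M m). same_part (P m \<omega>) (I m \<omega>) (J m \<omega>)}" for m
    define r where "r m = measure (M m) {\<omega> \<in> space (M m).
                same_part (P m \<omega>) (I m \<omega>) (J m \<omega>) \<and> same_part (P m \<omega>) (J m \<omega>) (K m \<omega>)}" for m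
    define s where "s m = measure (M m) {\<omega> \<in> space (M m).
                same_part (P m \<omega>) (I m \<omega>) (J m \<omega>) \<and> same_part (P m \<omega>) (J m \<omega>) (K m \<omega>) \<and>
                same_part (P m \<omega>) (K m \<omega>) (L m \<omega>)}" for m
    have a_le: "\<bar>a m i\<bar> \<le> A" for m i
      unfolding a_def A_def by (rule order_trans[OF sum_abs]) (auto intro!: sum_mono)
    have "\<exists>c>0. \<forall>\<^sub>F m in sequentially. S m \<ge> c * (\<Sum>i=1..m. \<Sum>j=1..m. p m i j)"
    proof -
      have "(\<Sum>i=1..m. \<Sum>j=1..m. step_coeff d \<rho> (\<lambda>g. \<Sum>h=g..d. \<beta> h) m i *
          step_coeff d \<rho> (\<lambda>g. \<Sum>h=g..d. \<beta> h) m j * p m i j) = S m" for m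
        unfolding S_def using step_coeff_tail_sums[OF assms(9,10) mono]
        by (intro sum.cong refl) (simp add: a_def n_def)
      then show ?thesis
        using iv[OF tail_sums_nonzero[OF \<beta>]] unfolding p_def by simp
    qed
    then obtain c where c: "c > 0"
      and S_ge: "\<forall>\<^sub>F m in sequentially. S m \<ge> c * (\<Sum>i=1..m. \<Sum>j=1..m. p m i j)" by blast
    have a_fun: "a m = (\<lambda>i. \<Sum>g=1..d. \<beta> g * of_bool (i \<le> n m g))" for m
      by (rule ext) (rule a_def)
    have V_eq: "V m = coloured_partition.linear_form m (P m) (C m) (a m)" if "m \<ge> 1" for m
    proof -
      interpret cp: coloured_partition "M m" N Y m "P m" "C m" by (rule part[OF that])
      show ?thesis
        using cp.sum_colour_sums[of "{1..d}" "n m" \<beta>] n_le by (simp add: V_def a_fun fun_eq_iff del: sum_mult_of_bool_eq)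
    qed
    have var: "prob_space.variance (M m) (V m) = colour.second_moment * S m" if "m \<ge> 1" for m
    proof -
      interpret cp: coloured_partition "M m" N Y m "P m" "C m" by (rule part[OF that])
      show ?thesis
        using cp.linear_form_second_moment(2)[of "a m"] cp.linear_form_mean(2)[of "a m"]
          cp.expectation_weight_square[of "a m"]
        unfolding V_eq[OF that] by (simp add: S_def p_def cp.pair_prob_def)
    qed
    have bound: "S m > 0 \<and> cmod (char (distr (M m) borel
          (\<lambda>\<omega>. V m \<omega> / sqrt (prob_space.variance (M m) (V m)))) t - exp (- (t\<^sup>2) / 2))
        \<le> colour.gaussian_error * A ^ 3 * (\<bar>t\<bar> / sqrt (colour.second_moment * c)) ^ 3 *
          (r m / q m powr (3 / 2)) + t\<^sup>2 / 2 * (sqrt 2 * A\<^sup>2 / c) * sqrt (s m / (q m)\<^sup>2)"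
      if m: "m \<ge> 1" and S_m: "S m \<ge> c * (\<Sum>i=1..m. \<Sum>j=1..m. p m i j)" for m t
    proof -
      interpret cp: coloured_partition "M m" N Y m "P m" "C m" by (rule part[OF m])
      have dom: "cp.pair_covariances_dominated"
        using iii[OF m] by (simp add: cp.pair_covariances_dominated_def cp.quadruple_prob_def)
      have S_eq: "(\<Sum>i=1..m. \<Sum>j=1..m. a m i * a m j * cp.pair_prob i j) = S m"
        by (simp add: S_def p_def cp.pair_prob_def)
      have "c * (\<Sum>i=1..m. \<Sum>j=1..m. cp.pair_prob i j) \<le> (\<Sum>i=1..m. \<Sum>j=1..m. a m i * a m j * cp.pair_prob i j)"
        using S_m unfolding S_eq by (simp add: p_def cp.pair_prob_def)
      note b = cp.normalised_linear_form_char_indices[OF m assms(12)[OF m] dom pos a_le c this]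
      show ?thesis
        using b(1) b(2)[of t] unfolding var[OF m] unfolding V_eq[OF m] S_eq q_def r_def s_def by (rule conjI)
    qed
    have ev: "\<forall>\<^sub>F m in sequentially. m \<ge> 1 \<and> S m \<ge> c * (\<Sum>i=1..m. \<Sum>j=1..m. p m i j)"
      using eventually_ge_at_top[of 1] S_ge by eventually_elim simp
    have var_pos: "\<forall>\<^sub>F m in sequentially. prob_space.variance (M m) (V m) > 0"
      using ev by eventually_elim (use bound var pos in auto)
    have "(\<lambda>m. r m / q m powr (3 / 2)) \<longlonglongrightarrow> 0" "(\<lambda>m. s m / (q m)\<^sup>2) \<longlonglongrightarrow> 0"
      using smalloD_tendsto[OF i] smalloD_tendsto[OF ii] by (simp_all add: r_def q_def s_def)
    then have "(\<lambda>m. colour.gaussian_error * A ^ 3 * (\<bar>t\<bar> / sqrt (colour.second_moment * c)) ^ 3 *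
          (r m / q m powr (3 / 2)) + t\<^sup>2 / 2 * (sqrt 2 * A\<^sup>2 / c) * sqrt (s m / (q m)\<^sup>2))
        \<longlonglongrightarrow> colour.gaussian_error * A ^ 3 * (\<bar>t\<bar> / sqrt (colour.second_moment * c)) ^ 3 * 0 +
          t\<^sup>2 / 2 * (sqrt 2 * A\<^sup>2 / c) * sqrt 0" for t
      by (intro tendsto_add tendsto_mult_left tendsto_real_sqrt)
    then have bound_lim: "(\<lambda>m. colour.gaussian_error * A ^ 3 * (\<bar>t\<bar> / sqrt (colour.second_moment * c)) ^ 3 *
          (r m / q m powr (3 / 2)) + t\<^sup>2 / 2 * (sqrt 2 * A\<^sup>2 / c) * sqrt (s m / (q m)\<^sup>2)) \<longlonglongrightarrow> 0" for t
      by (simp only: real_sqrt_zero mult_zero_right add_0_right)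
    define \<mu> where "\<mu> m = distr (M m) borel (\<lambda>\<omega>. V m \<omega> / sqrt (prob_space.variance (M m) (V m)))" for m
    have char_lim: "(\<lambda>m. char (\<mu> m) t) \<longlonglongrightarrow> char std_normal_distribution t" for t
    proof -
      have "(\<lambda>m. char (\<mu> m) t - exp (- (t\<^sup>2) / 2)) \<longlonglongrightarrow> 0"
        by (rule Lim_null_comparison[OF _ bound_lim[of t]], rule eventually_mono[OF ev])
          (use bound[of _ t] in \<open>auto simp: \<mu>_def\<close>)
      then show ?thesis
        by (simp add: char_std_normal_distribution LIM_zero_iff)
    qed
    \<comment> \<open>The index is shifted because \<open>M 0\<close> need not be a probability space, whereas the continuity
      theorem wants every member of the sequence to be a distribution.\<close>
    have "weak_conv_m (\<lambda>m. \<mu> (Suc m)) std_normal_distribution"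
    proof (rule levy_continuity)
      fix m
      interpret cp: coloured_partition "M (Suc m)" N Y "Suc m" "P (Suc m)" "C (Suc m)"
        by (rule part) simp
      have [measurable]: "V (Suc m) \<in> borel_measurable (M (Suc m))"
        unfolding V_eq[of "Suc m", simplified] by simp
      show "real_distribution (\<mu> (Suc m))"
        unfolding \<mu>_def by (rule cp.real_distribution_distr) simp
    qed (auto intro: real_dist_normal_dist LIMSEQ_Suc char_lim)
    then have "weak_conv_m \<mu> std_normal_distribution"
      unfolding weak_conv_m_def weak_conv_def by (auto intro: LIMSEQ_imp_Suc)
    with var_pos show "let V = \<lambda>m \<omega>. \<Sum>g=1..d. \<beta> g * colour_sum (P m) (C m) (n m g) \<omega> in
        (\<forall>\<^sub>F m in sequentially. prob_space.variance (M m) (V m) > 0) \<and>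
        weak_conv_m (\<lambda>m. distr (M m) borel (\<lambda>\<omega>. V m \<omega> / sqrt (prob_space.variance (M m) (V m))))
          std_normal_distribution"
      unfolding Let_def \<mu>_def V_def by blast
  qed
qed

end
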